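(* Let $(X,d,\nu)$ be a compact measured length space. Suppose that $(X,d,\nu)$ has $\infty$-Ricci curvature bounded below by $K>0$. Then for all $\mu\in P_2(X,\nu)$, $$\frac K2W_2(\mu,\nu)^2\le H_{\infty,\nu}(\mu).$$ Now let $\mu\in P_2^{ac}(X,\nu)$ be such that its density $\rho=\frac{d\mu}{d\nu}$ is a positive Lipschitz function on $X$. If $(X,d,\nu)$ has $\infty$-Ricci curvature bounded below by $K>0$, then $$H_{\infty,\nu}(\mu)\le W_2(\mu,\nu)\sqrt{I_{\infty,\nu}(\mu)}-\frac K2W_2(\mu,\nu)^2\le\frac1{2K}I_{\infty,\nu}(\mu).$$ If on the other hand $(X,d,\nu)$ has $\infty$-Ricci curvature bounded below by $K\le0$, then $$H_{\infty,\nu}(\mu)\le\mathrm{diam}(X)\sqrt{I_{\infty,\nu}(\mu)}-\frac K2\mathrm{diam}(X)^2.$$ If, for some $N\in(1,\infty]$, $(X,d,\nu)$ has nonnegative $N$-Ricci curvature, then $$H_{N,\nu}(\mu)\le\mathrm{diam}(X)\sqrt{I_{N,\nu}(\mu)}.$$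
   Context: A compact measured length space $(X,d,\nu)$ is a compact length space $(X,d)$ (the distance is the infimum of lengths of joining curves) with a Borel probability measure $\nu$. $P_2(X)$ is the set of Borel probability measures on $X$ with the quadratic Wasserstein metric $W_2(\mu_0,\mu_1)^2=\inf_\pi\int d(x_0,x_1)^2\,d\pi$ ($\pi$ ranging over couplings of $\mu_0,\mu_1$). A Wasserstein geodesic $\{\mu_t\}_{t\in[0,1]}$ is a minimizing geodesic of $P_2(X)$, parametrized so that $W_2(\mu_t,\mu_s)=|t-s|W_2(\mu_0,\mu_1)$. $P_2(X,\nu)=\{\mu\in P_2(X):\mathrm{supp}(\mu)\subset\mathrm{supp}(\nu)\}$, and $P_2^{ac}(X,\nu)$ is the set of its elements absolutely continuous with respect to $\nu$. For $N\in(1,\infty)$, $H_{N,\nu}(\mu)=N-N\int_X\rho^{1-\frac1N}\,d\nu$, where $\rho\nu$ is the absolutely continuous part in the Lebesgue decomposition of $\mu$ with respect to $\nu$; $H_{\infty,\nu}(\mu)=\int_X\rho\log\rho\,d\nu$ if $\mu=\rho\nu$, and $H_{\infty,\nu}(\mu)=\infty$ if $\mu$ is not absolutely continuous with respect to $\nu$. For a function $\rho$ on $X$, $|\nabla^-\rho|(x)=\limsup_{y\to x}\frac{[\rho(x)-\rho(y)]_+}{d(x,y)}$ (with value $0$ at isolated points), $a_+=\max(a,0)$. For $\mu=\rho\nu$ with $\rho$ positive Lipschitz, $I_{N,\nu}(\mu)=\left(\frac{N-1}{N}\right)^2\int_X\frac{|\nabla^-\rho|^2}{\rho^{\frac2N+1}}\,d\nu$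 for $1<N<\infty$ and $I_{\infty,\nu}(\mu)=\int_X\frac{|\nabla^-\rho|^2}{\rho}\,d\nu$. For a continuous convex $U:[0,\infty)\to\mathbb{R}$ with $U(0)=0$, put $U'(\infty)=\lim_{r\to\infty}U(r)/r$ and $U_\nu(\mu)=\int_X U(\rho)\,d\nu+U'(\infty)\mu_s(X)\in\mathbb{R}\cup\{\infty\}$, where $\mu=\rho\nu+\mu_s$ is the Lebesgue decomposition of $\mu$ with respect to $\nu$ (convention $\infty\cdot0=0$). $\mathcal{DC}_N$ ($N\in[1,\infty)$) is the set of such $U$ for which $\lambda\mapsto\lambda^N U(\lambda^{-N})$ is convex on $(0,\infty)$; $\mathcal{DC}_\infty$ is the set of such $U$ for which $\lambda\mapsto e^\lambda U(e^{-\lambda})$ is convex on $\mathbb{R}$. $(X,d,\nu)$ has nonnegative $N$-Ricci curvature ($N\in[1,\infty]$) if for all $\mu_0,\mu_1\in P_2(X,\nu)$ there is some Wasserstein geodesic $\{\mu_t\}$ from $\mu_0$ to $\mu_1$ such that for all $U\in\mathcal{DC}_N$ and all $t\in[0,1]$: $U_\nu(\mu_t)\le tU_\nu(\mu_1)+(1-t)U_\nu(\mu_0)$. Given $K\in\mathbb{R}$, for $U\in\mathcal{DC}_\infty$ put $p(r)=rU'_+(r)-U(r)$ ($U'_+$ the right derivative) and $\lambda(U)=\inf_{r>0}K\frac{p(r)}{r}\in\mathbb{R}\cup\{-\infty\}$. $(X,d,\nu)$ has $\infty$-Ricci curvature bounded below by $K$ if for all $\mu_0,\mu_1\in P_2(X,\nu)$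 there is some Wasserstein geodesic $\{\mu_t\}$ from $\mu_0$ to $\mu_1$ such that for all $U\in\mathcal{DC}_\infty$ and $t\in[0,1]$: $U_\nu(\mu_t)\le tU_\nu(\mu_1)+(1-t)U_\nu(\mu_0)-\frac12\lambda(U)t(1-t)W_2(\mu_0,\mu_1)^2$. *)

theory Defs
  imports "HOL-Probability.Probability"
begin

section \<open>Compact measured length spaces\<close>

text \<open>
  The space \<open>X\<close> is the universe of a type \<open>'a :: metric_space\<close> (with distance \<^const>\<open>dist\<close>).
  Every set and measure below is taken in, or over, that universe.
\<close>

definition curve_length :: "(real \<Rightarrow> 'a::metric_space) \<Rightarrow> ennreal" where
  "curve_length g =
     (SUP ts \<in> {ts. sorted ts \<and> set ts \<subseteq> {0..1}}.
        ennreal (\<Sum>i<length ts - 1. dist (g (ts ! i)) (g (ts ! Suc i))))"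

definition length_space :: "'a::metric_space itself \<Rightarrow> bool" where
  "length_space _ \<longleftrightarrow>
     (\<forall>x y::'a. ennreal (dist x y) =
        (INF g \<in> {g. path g \<and> pathstart g = x \<and> pathfinish g = y}. curve_length g))"

definition P2 :: "'a::metric_space measure set" where
  "P2 = {\<mu>. prob_space \<mu> \<and> sets \<mu> = sets borel}"

definition compact_measured_length_space :: "'a::metric_space measure \<Rightarrow> bool" where
  "compact_measured_length_space \<nu> \<longleftrightarrow>
     compact (UNIV :: 'a set) \<and> length_space TYPE('a) \<and> \<nu> \<in> P2"


section \<open>The quadratic Wasserstein space\<close>

definition couplings ::
    "'a::metric_space measure \<Rightarrow> 'a measure \<Rightarrow> ('a \<times> 'a) measure set" where
  "couplings \<mu>0 \<mu>1 =
     {\<pi>. sets \<pi> = sets borel \<and> distr \<pi> borel fst = \<mu>0 \<and> distr \<pi> borel snd = \<mu>1}"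

text \<open>
  On a compact space the squared distance is bounded and continuous, so the Bochner integral
  below is the usual one and the infimum is over a nonempty set of nonnegative reals.
\<close>

definition W2 :: "'a::metric_space measure \<Rightarrow> 'a measure \<Rightarrow> real" where
  "W2 \<mu>0 \<mu>1 = sqrt (INF \<pi> \<in> couplings \<mu>0 \<mu>1. \<integral>z. (dist (fst z) (snd z))\<^sup>2 \<partial>\<pi>)"

definition wasserstein_geodesic ::
    "(real \<Rightarrow> 'a::metric_space measure) \<Rightarrow> 'a measure \<Rightarrow> 'a measure \<Rightarrow> bool" where
  "wasserstein_geodesic \<gamma> \<mu>0 \<mu>1 \<longleftrightarrow>
     \<gamma> 0 = \<mu>0 \<and> \<gamma> 1 = \<mu>1 \<and> (\<forall>t\<in>{0..1}. \<gamma> t \<in> P2) \<and>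
     (\<forall>s\<in>{0..1}. \<forall>t\<in>{0..1}. W2 (\<gamma> t) (\<gamma> s) = \<bar>t - s\<bar> * W2 \<mu>0 \<mu>1)"

definition supp :: "'a::metric_space measure \<Rightarrow> 'a set" where
  "supp \<mu> = {x. \<forall>V. open V \<and> x \<in> V \<longrightarrow> emeasure \<mu> V > 0}"

definition P2_supp :: "'a::metric_space measure \<Rightarrow> 'a measure set" where
  "P2_supp \<nu> = {\<mu> \<in> P2. supp \<mu> \<subseteq> supp \<nu>}"

definition P2_ac :: "'a::metric_space measure \<Rightarrow> 'a measure set" where
  "P2_ac \<nu> = {\<mu> \<in> P2_supp \<nu>. absolutely_continuous \<nu> \<mu>}"


section \<open>Lebesgue decomposition\<close>

text \<open>
  \<^const>\<open>RN_deriv\<close> is identically 0 when the measure is not absolutely continuous, so it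
  does not give the density of the absolutely continuous part.  The density chosen below is
  unique up to \<open>\<nu>\<close>-null sets and the singular part is unique, so nothing depends on the choice.
\<close>

definition lebesgue_decomposition ::
    "'a::metric_space measure \<Rightarrow> 'a measure \<Rightarrow> ('a \<Rightarrow> real) \<Rightarrow> 'a measure \<Rightarrow> bool" where
  "lebesgue_decomposition \<nu> \<mu> \<rho> \<mu>s \<longleftrightarrow>
     \<rho> \<in> borel_measurable borel \<and> (\<forall>x. 0 \<le> \<rho> x) \<and> sets \<mu>s = sets borel \<and>
     (\<exists>A\<in>sets borel. emeasure \<nu> A = 0 \<and> emeasure \<mu>s (- A) = 0) \<and>
     (\<forall>B\<in>sets borel. emeasure \<mu> B = emeasure (density \<nu> (\<lambda>x. ennreal (\<rho> x))) B + emeasure \<mu>s B)"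

definition ac_density :: "'a::metric_space measure \<Rightarrow> 'a measure \<Rightarrow> 'a \<Rightarrow> real" where
  "ac_density \<nu> \<mu> = (SOME \<rho>. \<exists>\<mu>s. lebesgue_decomposition \<nu> \<mu> \<rho> \<mu>s)"

definition singular_part :: "'a::metric_space measure \<Rightarrow> 'a measure \<Rightarrow> 'a measure" where
  "singular_part \<nu> \<mu> = (SOME \<mu>s. \<exists>\<rho>. lebesgue_decomposition \<nu> \<mu> \<rho> \<mu>s)"


section \<open>Entropy and Fisher information functionals\<close>

text \<open>
  Integral with values in the extended reals; used only for functions whose negative part is
  integrable, so that the difference is never of the form \<open>\<infinity> - \<infinity>\<close>.
\<close>

definition ereal_integral :: "'a measure \<Rightarrow> ('a \<Rightarrow> real) \<Rightarrow> ereal" where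
  "ereal_integral M f =
     enn2ereal (\<integral>\<^sup>+x. ennreal (f x) \<partial>M) - enn2ereal (\<integral>\<^sup>+x. ennreal (- f x) \<partial>M)"

definition H :: "ereal \<Rightarrow> 'a::metric_space measure \<Rightarrow> 'a measure \<Rightarrow> ereal" where
  "H N \<nu> \<mu> =
     (if N = \<infinity> then
        (if absolutely_continuous \<nu> \<mu>
         then ereal_integral \<nu> (\<lambda>x. ac_density \<nu> \<mu> x * ln (ac_density \<nu> \<mu> x)) else \<infinity>)
      else let n = real_of_ereal N in
        ereal (n - n * (\<integral>x. ac_density \<nu> \<mu> x powr (1 - 1 / n) \<partial>\<nu>)))"

text \<open>At an isolated point the filter is trivial, and the upper limit in \<^typ>\<open>ennreal\<close> is then 0.\<close>

definition descending_slope :: "('a::metric_space \<Rightarrow> real) \<Rightarrow> 'a \<Rightarrow> ennreal" where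
  "descending_slope \<rho> x = Limsup (at x) (\<lambda>y. ennreal (max (\<rho> x - \<rho> y) 0 / dist x y))"

text \<open>
  The Fisher information of \<open>\<rho>\<nu>\<close>, for \<open>\<rho>\<close> positive and Lipschitz: the slope is then bounded by
  the Lipschitz constant, and (on a compact space) the integrand is bounded.  The argument is
  the density \<open>\<rho>\<close> itself, since the slope depends on \<open>\<rho>\<close> as a function on all of \<open>X\<close>.
\<close>

definition I :: "ereal \<Rightarrow> 'a::metric_space measure \<Rightarrow> ('a \<Rightarrow> real) \<Rightarrow> real" where
  "I N \<nu> \<rho> =
     (if N = \<infinity> then (\<integral>x. (enn2real (descending_slope \<rho> x))\<^sup>2 / \<rho> x \<partial>\<nu>)
      else let n = real_of_ereal N in
        ((n - 1) / n)\<^sup>2 *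
          (\<integral>x. (enn2real (descending_slope \<rho> x))\<^sup>2 / \<rho> x powr (2 / n + 1) \<partial>\<nu>))"


section \<open>Displacement convexity classes and Ricci bounds\<close>

text \<open>Only the values of \<open>U\<close> on \<open>[0, \<infinity>)\<close> matter.\<close>

definition entropy_function :: "(real \<Rightarrow> real) \<Rightarrow> bool" where
  "entropy_function U \<longleftrightarrow> continuous_on {0..} U \<and> convex_on {0..} U \<and> U 0 = 0"

definition slope_at_infinity :: "(real \<Rightarrow> real) \<Rightarrow> ereal" where
  "slope_at_infinity U = Lim at_top (\<lambda>r. ereal (U r / r))"

definition U_functional ::
    "(real \<Rightarrow> real) \<Rightarrow> 'a::metric_space measure \<Rightarrow> 'a measure \<Rightarrow> ereal" where
  "U_functional U \<nu> \<mu> =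
     ereal_integral \<nu> (\<lambda>x. U (ac_density \<nu> \<mu> x)) +
     slope_at_infinity U * enn2ereal (emeasure (singular_part \<nu> \<mu>) UNIV)"

definition DC :: "ereal \<Rightarrow> (real \<Rightarrow> real) set" where
  "DC N = {U. entropy_function U \<and>
     (if N = \<infinity> then convex_on UNIV (\<lambda>l. exp l * U (exp (- l)))
      else let n = real_of_ereal N in convex_on {0<..} (\<lambda>l. l powr n * U (l powr (- n))))}"

definition nonneg_ricci :: "ereal \<Rightarrow> 'a::metric_space measure \<Rightarrow> bool" where
  "nonneg_ricci N \<nu> \<longleftrightarrow>
     (\<forall>\<mu>0\<in>P2_supp \<nu>. \<forall>\<mu>1\<in>P2_supp \<nu>. \<exists>\<gamma>. wasserstein_geodesic \<gamma> \<mu>0 \<mu>1 \<and>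
        (\<forall>U\<in>DC N. \<forall>t\<in>{0..1}.
           U_functional U \<nu> (\<gamma> t) \<le>
             ereal t * U_functional U \<nu> \<mu>1 + ereal (1 - t) * U_functional U \<nu> \<mu>0))"

definition right_deriv :: "(real \<Rightarrow> real) \<Rightarrow> real \<Rightarrow> real" where
  "right_deriv U r = Lim (at_right r) (\<lambda>s. (U s - U r) / (s - r))"

definition pressure :: "(real \<Rightarrow> real) \<Rightarrow> real \<Rightarrow> real" where
  "pressure U r = r * right_deriv U r - U r"

definition lambda_const :: "real \<Rightarrow> (real \<Rightarrow> real) \<Rightarrow> ereal" where
  "lambda_const K U = (INF r\<in>{0<..}. ereal (K * pressure U r / r))"

definition inf_ricci_ge :: "real \<Rightarrow> 'a::metric_space measure \<Rightarrow> bool" where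
  "inf_ricci_ge K \<nu> \<longleftrightarrow>
     (\<forall>\<mu>0\<in>P2_supp \<nu>. \<forall>\<mu>1\<in>P2_supp \<nu>. \<exists>\<gamma>. wasserstein_geodesic \<gamma> \<mu>0 \<mu>1 \<and>
        (\<forall>U\<in>DC \<infinity>. \<forall>t\<in>{0..1}.
           U_functional U \<nu> (\<gamma> t) \<le>
             ereal t * U_functional U \<nu> \<mu>1 + ereal (1 - t) * U_functional U \<nu> \<mu>0
             - lambda_const K U * ereal (t * (1 - t) / 2 * (W2 \<mu>0 \<mu>1)\<^sup>2)))"

end

theory Submission
  imports Defs "HOL-Real_Asymp.Real_Asymp"
begin

text \<open>
  Along a Wasserstein geodesic \<open>\<mu>\<^sub>t\<close> from \<open>\<mu> = \<rho>\<nu>\<close> to \<open>\<nu>\<close>, displacement convexity of an entropy \<open>U\<close> with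
  \<open>U(1) = 0\<close> bounds \<open>U\<^sub>\<nu>(\<mu>)\<close> by the initial rate of decrease of \<open>U\<^sub>\<nu>(\<mu>\<^sub>t)\<close>. As \<open>U\<close> lies above its
  tangents, this rate is at most that of \<open>\<integral> U'(\<rho>) d\<mu>\<^sub>t\<close>. Along any coupling of \<open>\<mu>\<close> and \<open>\<mu>\<^sub>t\<close>,
  \<open>U'(\<rho>)\<close> decreases by at most \<open>U''(\<rho>(x)) g\<^sub>n(x) d(x, y) + C\<^sub>n d(x, y)\<^sup>2\<close>, where \<open>g\<^sub>n(x)\<close> is the steepest
  descent of \<open>\<rho>\<close> from \<open>x\<close> over distances below \<open>1 / (n + 1)\<close>. By Cauchy--Schwarz the integral of this
  bound is \<open>\<le> t W\<^sub>2(\<mu>, \<nu>) (\<integral> (U''(\<rho>) g\<^sub>n)\<^sup>2 d\<mu>)\<^sup>1\<^sup>/\<^sup>2 + O(t\<^sup>2)\<close>. Letting \<open>t \<rightarrow> 0\<close> and then \<open>n \<rightarrow> \<infinity>\<close>, where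
  \<open>g\<^sub>n\<close> decreases to the descending slope, gives the bounds by the Fisher information; no measure on the
  space of geodesics is needed. The transport inequality follows from \<open>U\<^sub>\<nu>(\<mu>\<^sub>t) \<ge> 0\<close> as \<open>t \<rightarrow> 1\<close>.
\<close>

section \<open>Lebesgue decomposition\<close>

lemma P2_D:
  assumes "\<mu> \<in> P2"
  shows "prob_space \<mu>" "sets \<mu> = sets borel" "space \<mu> = UNIV"
  using assms sets_eq_imp_space_eq[of \<mu> borel] by (auto simp: P2_def)

text \<open>A \<open>\<nu>\<close>-null set \<open>A\<close> of maximal \<open>\<mu>\<close>-mass
  takes up all the singular mass: what \<open>\<mu>\<close> leaves outside \<open>A\<close> is
  absolutely continuous, and Radon-Nikodym gives its density.\<close>

lemma lebesgue_decomposition_exists: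
  assumes \<nu>: "\<nu> \<in> P2" and \<mu>: "\<mu> \<in> P2"
  shows "\<exists>\<rho> \<mu>s. lebesgue_decomposition \<nu> \<mu> \<rho> \<mu>s"
proof -
  interpret n: prob_space \<nu> using P2_D[OF \<nu>] by simp
  interpret m: prob_space \<mu> using P2_D[OF \<mu>] by simp
  note [measurable_cong] = P2_D(2)[OF \<nu>] P2_D(2)[OF \<mu>]
  note sets_eq = P2_D(2)[OF \<nu>] P2_D(2)[OF \<mu>]
  \<comment> \<open>The carrier of the singular part is a \<open>\<nu>\<close>-null set of maximal \<open>\<mu>\<close>-measure.\<close>
  define S where "S = (SUP A\<in>null_sets \<nu>. emeasure \<mu> A)"
  have "null_sets \<nu> \<noteq> {}" by auto
  from ennreal_SUP_countable_SUP[OF this, of "emeasure \<mu>"]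
  obtain s :: "nat \<Rightarrow> ennreal" where s: "range s \<subseteq> emeasure \<mu> ` null_sets \<nu>" "S = (SUP i. s i)"
    unfolding S_def by auto
  then have "\<forall>i. \<exists>A. s i = emeasure \<mu> A \<and> A \<in> null_sets \<nu>" by auto
  then obtain Q where Q: "\<And>i. s i = emeasure \<mu> (Q i)" "\<And>i. Q i \<in> null_sets \<nu>" by metis
  define A where "A = (\<Union>i. Q i)"
  have A0: "A \<in> null_sets \<nu>" using Q unfolding A_def by auto
  have A[measurable]: "A \<in> sets borel" using A0 sets_eq by auto
  have AS: "emeasure \<mu> A = S"
  proof (rule antisym)
    show "emeasure \<mu> A \<le> S" unfolding S_def by (rule SUP_upper[OF A0])
    show "S \<le> emeasure \<mu> A" unfolding s(2) Q(1)
      by (rule SUP_least, rule emeasure_mono) (auto simp: A_def sets_eq A[unfolded A_def])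
  qed
  define \<mu>a where "\<mu>a = density \<mu> (indicator (- A))"
  define \<mu>s where "\<mu>s = density \<mu> (indicator A)"
  have ea: "emeasure \<mu>a B = emeasure \<mu> (B - A)" if "B \<in> sets borel" for B
    unfolding \<mu>a_def using that A by (simp add: emeasure_restricted sets_eq Diff_eq Int_commute)
  have es: "emeasure \<mu>s B = emeasure \<mu> (B \<inter> A)" if "B \<in> sets borel" for B
    unfolding \<mu>s_def using that A by (simp add: emeasure_restricted sets_eq Int_commute)
  \<comment> \<open>Adding a null set \<open>B\<close> to \<open>A\<close> gives a null set again,
    so by maximality \<open>B - A\<close> adds no mass; the cancellation uses that \<mu> is
    finite.\<close>
  have "absolutely_continuous \<nu> \<mu>a"
    unfolding absolutely_continuous_def
  proof
    fix B assume B: "B \<in> null_sets \<nu>"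
    then have Bs[measurable]: "B \<in> sets borel" using sets_eq by auto
    have "A \<union> B \<in> null_sets \<nu>" using A0 B by auto
    then have "emeasure \<mu> (A \<union> B) \<le> S" unfolding S_def by (rule SUP_upper)
    moreover have "emeasure \<mu> (A \<union> B) = emeasure \<mu> A + emeasure \<mu> (B - A)"
      by (subst plus_emeasure) (auto simp: sets_eq)
    ultimately have "emeasure \<mu> A + emeasure \<mu> (B - A) \<le> emeasure \<mu> A + 0" using AS by simp
    then have "emeasure \<mu> (B - A) = 0"
      using m.emeasure_finite[of A] by (subst (asm) ennreal_add_left_cancel_le) auto
    then show "B \<in> null_sets \<mu>a" using ea[OF Bs] Bs by (auto simp: null_sets_def \<mu>a_def sets_eq)
  qed
  from n.Radon_Nikodym[OF this] obtain f where f: "f \<in> borel_measurable \<nu>" "density \<nu> f = \<mu>a"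
    by (auto simp: \<mu>a_def sets_eq)
  have "(\<integral>\<^sup>+x. f x \<partial>\<nu>) = emeasure \<mu>a UNIV"
    unfolding f(2)[symmetric] using f(1) P2_D(3)[OF \<nu>]
    by (subst emeasure_density) (auto simp: sets_eq)
  also have "\<dots> \<noteq> \<infinity>" using ea[of UNIV] m.emeasure_finite by simp
  finally have fin: "AE x in \<nu>. f x \<noteq> \<infinity>" using f(1) by (intro nn_integral_PInf_AE) auto
  \<comment> \<open>The density \<open>f\<close> may be infinite on a null set, where
    \<open>enn2real\<close> puts 0; the measure it defines stays the same.\<close>
  define \<rho> where "\<rho> x = enn2real (f x)" for x
  have f': "f \<in> borel_measurable borel" using f(1) by simp
  have \<rho>: "\<rho> \<in> borel_measurable borel" unfolding \<rho>_def using f' by measurable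
  have dens: "density \<nu> (\<lambda>x. ennreal (\<rho> x)) = \<mu>a"
    unfolding f(2)[symmetric] using f(1) \<rho> fin
    by (intro density_cong) (auto simp: \<rho>_def less_top elim!: eventually_mono)
  have "emeasure \<mu> B = emeasure (density \<nu> (\<lambda>x. ennreal (\<rho> x))) B + emeasure \<mu>s B"
    if "B \<in> sets borel" for B
    unfolding dens ea[OF that] es[OF that]
    using that A by (subst plus_emeasure) (auto simp: sets_eq intro!: arg_cong[where f="emeasure \<mu>"])
  moreover have "\<exists>A\<in>sets borel. emeasure \<nu> A = 0 \<and> emeasure \<mu>s (- A) = 0"
    using A A0 by (intro bexI[of _ A]) (auto simp: es)
  moreover have "sets \<mu>s = sets borel" by (simp add: \<mu>s_def sets_eq)
  ultimately have "lebesgue_decomposition \<nu> \<mu> \<rho> \<mu>s"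
    using \<rho> by (simp add: lebesgue_decomposition_def \<rho>_def)
  then show ?thesis by blast
qed

text \<open>Any set \<open>A\<close> that witnesses mutual singularity recovers both parts as
  restrictions of \<mu>. The parts are thus determined by \<open>A\<close>, which reduces uniqueness
  to finding a common witness.\<close>

lemma lebesgue_decomposition_split:
  assumes \<nu>: "\<nu> \<in> P2" and \<mu>: "\<mu> \<in> P2" and dec: "lebesgue_decomposition \<nu> \<mu> \<rho> \<mu>s"
    and A[measurable]: "A \<in> sets borel" and A0: "emeasure \<nu> A = 0" "emeasure \<mu>s (- A) = 0"
  shows "density \<nu> (\<lambda>x. ennreal (\<rho> x)) = density \<mu> (\<lambda>x. ennreal (indicator (- A) x))"
    and "\<mu>s = density \<mu> (\<lambda>x. ennreal (indicator A x))"
proof -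
  note sets_eq = P2_D(2)[OF \<nu>] P2_D(2)[OF \<mu>]
  note [measurable_cong] = sets_eq
  let ?a = "density \<nu> (\<lambda>x. ennreal (\<rho> x))"
  have \<rho>[measurable]: "\<rho> \<in> borel_measurable borel" and ss: "sets \<mu>s = sets borel"
    and eq: "\<And>B. B \<in> sets borel \<Longrightarrow> emeasure \<mu> B = emeasure ?a B + emeasure \<mu>s B"
    using dec by (auto simp: lebesgue_decomposition_def)
  have n0: "A \<in> null_sets \<nu>" using A0 A sets_eq by auto
  have "AE x in \<nu>. x \<in> A \<longrightarrow> ennreal (\<rho> x) = 0" using AE_not_in[OF n0] by (auto elim!: eventually_mono)
  \<comment> \<open>Each part vanishes where the other one lives: the absolutely continuous part on
    \<open>A\<close>, the singular part off \<open>A\<close>.\<close>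
  then have Aa: "A \<in> null_sets ?a"
    by (subst null_sets_density_iff) (auto simp: sets_eq A)
  have a0: "emeasure ?a (B \<inter> A) = 0" if "B \<in> sets borel" for B
    by (rule emeasure_eq_0[OF null_setsD2[OF Aa] null_setsD1[OF Aa] Int_lower2])
  have s0: "emeasure \<mu>s (B - A) = 0" if "B \<in> sets borel" for B
    by (rule emeasure_eq_0[OF _ A0(2)]) (auto simp: ss)
  have split: "emeasure M B = emeasure M (B - A) + emeasure M (B \<inter> A)"
    if "B \<in> sets borel" "sets M = sets borel" for M B
  proof -
    have "(B - A) \<union> (B \<inter> A) = B" "(B - A) \<inter> (B \<inter> A) = {}" by blast+
    then show ?thesis using that A plus_emeasure[of "B - A" M "B \<inter> A"] by simp
  qed
  show "?a = density \<mu> (\<lambda>x. ennreal (indicator (- A) x))"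
  proof (rule measure_eqI)
    fix B assume "B \<in> sets ?a"
    then have B[measurable]: "B \<in> sets borel" by (simp add: sets_eq)
    have "emeasure ?a B = emeasure ?a (B - A)"
      using split[of B ?a] a0[of B] B by (simp add: sets_eq)
    also have "\<dots> = emeasure \<mu> (B - A)" using eq[of "B - A"] s0[of B] B A by simp
    also have "\<dots> = emeasure (density \<mu> (\<lambda>x. ennreal (indicator (- A) x))) B"
      using A B by (simp add: ennreal_indicator emeasure_restricted sets_eq Diff_eq Int_commute)
    finally show "emeasure ?a B = \<dots>" .
  qed (simp add: sets_eq)
  show "\<mu>s = density \<mu> (\<lambda>x. ennreal (indicator A x))"
  proof (rule measure_eqI)
    fix B assume "B \<in> sets \<mu>s"
    then have B[measurable]: "B \<in> sets borel" by (simp add: ss)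
    have "emeasure \<mu>s B = emeasure \<mu>s (B \<inter> A)"
      using split[of B \<mu>s] s0[of B] B by (simp add: ss)
    also have "\<dots> = emeasure \<mu> (B \<inter> A)" using eq[of "B \<inter> A"] a0[of B] B A by simp
    also have "\<dots> = emeasure (density \<mu> (\<lambda>x. ennreal (indicator A x))) B"
      using A B by (simp add: ennreal_indicator emeasure_restricted sets_eq Int_commute)
    finally show "emeasure \<mu>s B = \<dots>" .
  qed (simp add: sets_eq ss)
qed

text \<open>The union of the two witnessing sets is a witness for both decompositions, so their
  parts are the same restrictions of \<mu>.\<close>

lemma lebesgue_decomposition_unique:
  assumes \<nu>: "\<nu> \<in> P2" and \<mu>: "\<mu> \<in> P2" and dec: "lebesgue_decomposition \<nu> \<mu> \<rho> \<mu>s"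
    and dec': "lebesgue_decomposition \<nu> \<mu> \<rho>' \<mu>s'"
  shows "\<mu>s = \<mu>s'" and "AE x in \<nu>. \<rho> x = \<rho>' x"
proof -
  interpret n: prob_space \<nu> using P2_D[OF \<nu>] by simp
  note sets_eq = P2_D(2)[OF \<nu>] P2_D(2)[OF \<mu>]
  note [measurable_cong] = sets_eq
  obtain A where A: "A \<in> sets borel" "emeasure \<nu> A = 0" "emeasure \<mu>s (- A) = 0"
    using dec by (auto simp: lebesgue_decomposition_def)
  obtain A' where A': "A' \<in> sets borel" "emeasure \<nu> A' = 0" "emeasure \<mu>s' (- A') = 0"
    using dec' by (auto simp: lebesgue_decomposition_def)
  have ss: "sets \<mu>s = sets borel" "sets \<mu>s' = sets borel"
    and \<rho>: "\<rho> \<in> borel_measurable borel" "\<rho>' \<in> borel_measurable borel" "\<And>x. \<rho> x \<ge> 0" "\<And>x. \<rho>' x \<ge> 0"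
    using dec dec' by (auto simp: lebesgue_decomposition_def)
  let ?B = "A \<union> A'"
  have "A \<union> A' \<in> null_sets \<nu>" using A A' sets_eq by (intro null_sets.Un) auto
  then have B: "?B \<in> sets borel" "emeasure \<nu> ?B = 0" "emeasure \<mu>s (- ?B) = 0" "emeasure \<mu>s' (- ?B) = 0"
    using A A' ss by (auto intro: emeasure_eq_0[of "- A"] emeasure_eq_0[of "- A'"])
  note s = lebesgue_decomposition_split[OF \<nu> \<mu> dec B(1,2,3)]
  note s' = lebesgue_decomposition_split[OF \<nu> \<mu> dec' B(1,2,4)]
  show "\<mu>s = \<mu>s'" using s s' by simp
  have "density \<nu> (\<lambda>x. ennreal (\<rho> x)) = density \<nu> (\<lambda>x. ennreal (\<rho>' x))" using s s' by simp
  then have "AE x in \<nu>. ennreal (\<rho> x) = ennreal (\<rho>' x)"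
    using \<rho> by (subst (asm) n.density_unique_iff) auto
  then show "AE x in \<nu>. \<rho> x = \<rho>' x" using \<rho> by (auto elim!: eventually_mono)
qed

text \<open>The density and the singular part are chosen by separate uses of \<open>SOME\<close> and
  could come from different decompositions; uniqueness of the singular part makes them fit
  together.\<close>

lemma lebesgue_decomposition_canonical:
  assumes \<nu>: "\<nu> \<in> P2" and \<mu>: "\<mu> \<in> P2"
  shows "lebesgue_decomposition \<nu> \<mu> (ac_density \<nu> \<mu>) (singular_part \<nu> \<mu>)"
proof -
  have ex: "\<exists>\<rho> \<mu>s. lebesgue_decomposition \<nu> \<mu> \<rho> \<mu>s" "\<exists>\<mu>s \<rho>. lebesgue_decomposition \<nu> \<mu> \<rho> \<mu>s"
    using lebesgue_decomposition_exists[OF assms] by blast+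
  obtain \<mu>s where 1: "lebesgue_decomposition \<nu> \<mu> (ac_density \<nu> \<mu>) \<mu>s"
    using someI_ex[OF ex(1)] unfolding ac_density_def by blast
  obtain \<rho> where 2: "lebesgue_decomposition \<nu> \<mu> \<rho> (singular_part \<nu> \<mu>)"
    using someI_ex[OF ex(2)] unfolding singular_part_def by blast
  show ?thesis using 1 lebesgue_decomposition_unique(1)[OF assms 1 2] by simp
qed

text \<open>Both parts are restrictions of the probability measure \<mu>, so a bounded function is
  integrable against each, and its integral splits along the indicators of \<open>A\<close> and its
  complement.\<close>

lemma lebesgue_decomposition_integral:
  fixes f :: "'a::metric_space \<Rightarrow> real"
  assumes \<nu>: "\<nu> \<in> P2" and \<mu>: "\<mu> \<in> P2" and dec: "lebesgue_decomposition \<nu> \<mu> \<rho> \<mu>s"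
    and f[measurable]: "f \<in> borel_measurable borel" and bnd: "\<And>x. \<bar>f x\<bar> \<le> C"
  shows "integrable \<nu> (\<lambda>x. \<rho> x * f x)" "integrable \<mu>s f"
    "(\<integral>x. f x \<partial>\<mu>) = (\<integral>x. \<rho> x * f x \<partial>\<nu>) + (\<integral>x. f x \<partial>\<mu>s)"
proof -
  interpret m: prob_space \<mu> using P2_D[OF \<mu>] by simp
  note sets_eq = P2_D(2)[OF \<nu>] P2_D(2)[OF \<mu>]
  note [measurable_cong] = sets_eq
  obtain A where A[measurable]: "A \<in> sets borel" and A0: "emeasure \<nu> A = 0" "emeasure \<mu>s (- A) = 0"
    using dec by (auto simp: lebesgue_decomposition_def)
  have \<rho>[measurable]: "\<rho> \<in> borel_measurable borel" and \<rho>0: "\<And>x. \<rho> x \<ge> 0"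
    using dec by (auto simp: lebesgue_decomposition_def)
  note s = lebesgue_decomposition_split[OF \<nu> \<mu> dec A A0]
  have int: "integrable \<mu> f"
    by (rule m.integrable_const_bound[of _ C]) (auto simp: bnd)
  have iA: "integrable \<mu> (\<lambda>x. indicator B x * f x)" if [measurable]: "B \<in> sets borel" for B
    by (rule m.integrable_const_bound[of _ C])
      (auto simp: indicator_def bnd intro: order_trans[OF abs_ge_zero bnd])
  have "integrable (density \<nu> (\<lambda>x. ennreal (\<rho> x))) f"
    unfolding s(1) using iA[of "- A"] by (subst integrable_density) auto
  then show "integrable \<nu> (\<lambda>x. \<rho> x * f x)" using \<rho>0 by (subst (asm) integrable_density) auto
  show "integrable \<mu>s f" unfolding s(2) using iA[of A] by (subst integrable_density) auto
  have "(\<integral>x. \<rho> x * f x \<partial>\<nu>) = (\<integral>x. f x \<partial>density \<nu> (\<lambda>x. ennreal (\<rho> x)))"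
    using \<rho>0 by (subst integral_density) auto
  also have "\<dots> = (\<integral>x. indicator (- A) x * f x \<partial>\<mu>)"
    unfolding s(1) by (subst integral_density) auto
  finally have 1: "(\<integral>x. \<rho> x * f x \<partial>\<nu>) = \<dots>" .
  have 2: "(\<integral>x. f x \<partial>\<mu>s) = (\<integral>x. indicator A x * f x \<partial>\<mu>)"
    unfolding s(2) by (subst integral_density) auto
  have "(\<integral>x. f x \<partial>\<mu>) = (\<integral>x. indicator (- A) x * f x + indicator A x * f x \<partial>\<mu>)"
    by (intro Bochner_Integration.integral_cong) (auto simp: indicator_def)
  also have "\<dots> = (\<integral>x. indicator (- A) x * f x \<partial>\<mu>) + (\<integral>x. indicator A x * f x \<partial>\<mu>)"
    using iA by (intro Bochner_Integration.integral_add) auto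
  finally show "(\<integral>x. f x \<partial>\<mu>) = (\<integral>x. \<rho> x * f x \<partial>\<nu>) + (\<integral>x. f x \<partial>\<mu>s)" using 1 2 by simp
qed

lemma singular_part_ac:
  assumes \<nu>: "\<nu> \<in> P2" and \<mu>: "\<mu> \<in> P2" and ac: "absolutely_continuous \<nu> \<mu>"
  shows "emeasure (singular_part \<nu> \<mu>) UNIV = 0"
proof -
  let ?s = "singular_part \<nu> \<mu>"
  note dec = lebesgue_decomposition_canonical[OF \<nu> \<mu>]
  obtain A where A: "A \<in> sets borel" "emeasure \<nu> A = 0" "emeasure ?s (- A) = 0"
    using dec by (auto simp: lebesgue_decomposition_def)
  have "emeasure \<mu> A = 0"
    using ac A P2_D(2)[OF \<nu>] by (auto simp: absolutely_continuous_def null_sets_def)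
  then have "emeasure ?s A = 0" using dec A by (auto simp: lebesgue_decomposition_def)
  then show ?thesis
    using plus_emeasure[of A ?s "- A"] A dec by (auto simp: lebesgue_decomposition_def)
qed

text \<open>The given density together with the zero measure is one decomposition, so uniqueness
  identifies the chosen one with it.\<close>

lemma ac_density_density:
  assumes \<nu>: "\<nu> \<in> P2" and \<mu>: "density \<nu> (\<lambda>x. ennreal (\<rho> x)) \<in> P2"
    and \<rho>: "\<rho> \<in> borel_measurable borel" "\<And>x. \<rho> x \<ge> 0"
  shows "AE x in \<nu>. ac_density \<nu> (density \<nu> (\<lambda>x. ennreal (\<rho> x))) x = \<rho> x"
    and "emeasure (singular_part \<nu> (density \<nu> (\<lambda>x. ennreal (\<rho> x)))) UNIV = 0"
proof -
  have dec: "lebesgue_decomposition \<nu> (density \<nu> (\<lambda>x. ennreal (\<rho> x))) \<rho> (null_measure borel)"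
    using \<rho> by (auto simp: lebesgue_decomposition_def)
  note u = lebesgue_decomposition_unique[OF \<nu> \<mu> lebesgue_decomposition_canonical[OF \<nu> \<mu>] dec]
  show "AE x in \<nu>. ac_density \<nu> (density \<nu> (\<lambda>x. ennreal (\<rho> x))) x = \<rho> x" using u(2) .
  show "emeasure (singular_part \<nu> (density \<nu> (\<lambda>x. ennreal (\<rho> x)))) UNIV = 0" using u(1) by simp
qed

section \<open>Integrals with values in the extended reals\<close>

lemma ereal_integral_integrable:
  assumes "integrable M f"
  shows "ereal_integral M f = ereal (\<integral>x. f x \<partial>M)"
proof -
  have "(\<integral>\<^sup>+x. ennreal (f x) \<partial>M) < \<infinity>" "(\<integral>\<^sup>+x. ennreal (- f x) \<partial>M) < \<infinity>"
    using assms by (auto simp: real_integrable_def less_top)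
  then show ?thesis
    unfolding ereal_integral_def real_lebesgue_integral_def[OF assms]
    by (cases "\<integral>\<^sup>+x. ennreal (f x) \<partial>M"; cases "\<integral>\<^sup>+x. ennreal (- f x) \<partial>M")
      (auto simp: enn2ereal_ennreal)
qed

text \<open>An integrable minorant keeps the negative part finite, so the defining difference is
  never of the form infinity minus infinity. Either the positive part is infinite, or
  \<open>f\<close> is integrable and ordinary monotonicity applies.\<close>

lemma ereal_integral_ge:
  assumes l: "integrable M l" and f: "f \<in> borel_measurable M" and le: "\<And>x. l x \<le> f x"
  shows "ereal (\<integral>x. l x \<partial>M) \<le> ereal_integral M f"
proof (cases "(\<integral>\<^sup>+x. ennreal (f x) \<partial>M) = \<infinity>")
  case True
  have "(\<integral>\<^sup>+x. ennreal (- f x) \<partial>M) \<le> (\<integral>\<^sup>+x. ennreal (- l x) \<partial>M)"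
    using le by (intro nn_integral_mono ennreal_leI) auto
  also have "\<dots> < \<infinity>" using l by (auto simp: real_integrable_def less_top)
  finally obtain r where "(\<integral>\<^sup>+x. ennreal (- f x) \<partial>M) = ennreal r" "r \<ge> 0"
    by (cases "\<integral>\<^sup>+x. ennreal (- f x) \<partial>M") auto
  then show ?thesis using True by (simp add: ereal_integral_def enn2ereal_ennreal)
next
  case False
  have "(\<integral>\<^sup>+x. ennreal (- f x) \<partial>M) \<le> (\<integral>\<^sup>+x. ennreal (- l x) \<partial>M)"
    using le by (intro nn_integral_mono ennreal_leI) auto
  also have "\<dots> < \<infinity>" using l by (auto simp: real_integrable_def less_top)
  finally have i: "integrable M f" using f False by (auto simp: real_integrable_def)
  show ?thesis unfolding ereal_integral_integrable[OF i]
    using l i le by (simp add: integral_mono)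
qed

section \<open>Couplings\<close>

text \<open>Couplings carry the Borel sets of the product topology, whereas product measures live on
  the product sigma-algebra. On a compact space finite nets at every scale provide countably many
  boxes that generate the open sets, so the two agree.\<close>

lemma sets_borel_prod_compact:
  assumes "compact (UNIV :: 'a::metric_space set)"
  shows "sets (borel \<Otimes>\<^sub>M borel :: ('a \<times> 'a) measure) = sets borel"
proof
  show "sets (borel \<Otimes>\<^sub>M borel :: ('a \<times> 'a) measure) \<subseteq> sets borel"
  proof (rule sets_pair_in_sets)
    fix A B :: "'a set" assume "A \<in> sets borel" "B \<in> sets borel"
    moreover have [measurable]: "(fst :: 'a \<times> 'a \<Rightarrow> 'a) \<in> borel_measurable borel"
      "(snd :: 'a \<times> 'a \<Rightarrow> 'a) \<in> borel_measurable borel"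
      by (auto intro!: borel_measurable_continuous_onI continuous_intros)
    ultimately have "fst -` A \<inter> snd -` B \<inter> space borel \<in> sets (borel :: ('a \<times> 'a) measure)"
      by measurable
    also have "fst -` A \<inter> snd -` B \<inter> space borel = A \<times> B" by auto
    finally show "A \<times> B \<in> sets borel" .
  qed
next
  have "\<exists>F. finite F \<and> (UNIV :: 'a set) = (\<Union>x\<in>F. ball x (1 / real (Suc n)))" for n
    using assms compactE_image[of UNIV UNIV "\<lambda>x::'a. ball x (1 / real (Suc n))"]
    by (metis (no_types, lifting) UNIV_I UN_I centre_in_ball of_nat_0_less_iff open_ball
        subsetI top.extremum_uniqueI zero_less_Suc zero_less_divide_1_iff)
  then obtain F where F: "\<And>n. finite (F n)" "\<And>n. (UNIV :: 'a set) = (\<Union>x\<in>F n. ball x (1 / real (Suc n)))"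
    by metis
  have "U \<in> sets (borel \<Otimes>\<^sub>M borel)" if U: "open U" for U :: "('a \<times> 'a) set"
  proof -
    \<comment> \<open>The countable index set: a scale \<open>n\<close> and two net points whose box
      of that scale lies in \<open>U\<close>.\<close>
    let ?R = "{(n, x, y). x \<in> F n \<and> y \<in> F n \<and> ball x (1 / real (Suc n)) \<times> ball y (1 / real (Suc n)) \<subseteq> U}"
    have V: "U = (\<Union>(n, x, y)\<in>?R. ball x (1 / real (Suc n)) \<times> ball y (1 / real (Suc n)))" (is "_ = ?V")
    proof
      show "U \<subseteq> ?V"
      proof
        fix p assume "p \<in> U"
        obtain a b where p: "p = (a, b)" by force
        from U \<open>p \<in> U\<close> obtain A B where AB: "open A" "open B" "a \<in> A" "b \<in> B" "A \<times> B \<subseteq> U"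
          unfolding p by (elim open_prod_elim) auto
        then obtain e e' where e: "e > 0" "ball a e \<subseteq> A" "e' > 0" "ball b e' \<subseteq> B"
          by (meson open_contains_ball)
        \<comment> \<open>Half the radius is needed because a ball around a net point near
          \<open>a\<close> reaches up to twice its own radius away from \<open>a\<close>.\<close>
        obtain n where "1 / real (Suc n) < min e e' / 2"
          using e reals_Archimedean[of "min e e' / 2"] by (auto simp: inverse_eq_divide)
        then have n: "1 / real (Suc n) < e / 2" "1 / real (Suc n) < e' / 2" by auto
        obtain x y where xy: "x \<in> F n" "y \<in> F n" "dist x a < 1 / real (Suc n)" "dist y b < 1 / real (Suc n)"
          using F(2)[of n] by (metis UNIV_I UN_E mem_ball)
        have "ball x (1 / real (Suc n)) \<subseteq> ball a e"
        proof
          fix z assume "z \<in> ball x (1 / real (Suc n))"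
          then show "z \<in> ball a e" using dist_triangle[of a z x] xy(3) n(1)
            by (simp only: mem_ball dist_commute)
        qed
        moreover have "ball y (1 / real (Suc n)) \<subseteq> ball b e'"
        proof
          fix z assume "z \<in> ball y (1 / real (Suc n))"
          then show "z \<in> ball b e'" using dist_triangle[of b z y] xy(4) n(2)
            by (simp only: mem_ball dist_commute)
        qed
        ultimately have "ball x (1 / real (Suc n)) \<times> ball y (1 / real (Suc n)) \<subseteq> U"
          using e AB by blast
        then have "(n, x, y) \<in> ?R" using xy by auto
        moreover have "p \<in> ball x (1 / real (Suc n)) \<times> ball y (1 / real (Suc n))"
          using xy p by auto
        ultimately show "p \<in> ?V" by blast
      qed
    qed auto
    moreover have "countable ?R"
    proof (rule countable_subset)
      show "?R \<subseteq> Sigma UNIV (\<lambda>n. F n \<times> F n)" by auto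
      show "countable (Sigma UNIV (\<lambda>n. F n \<times> F n))"
        using F(1) by (auto intro!: countable_SIGMA intro: countable_finite)
    qed
    moreover have "ball x r \<times> ball y r \<in> sets (borel \<Otimes>\<^sub>M borel)" for x y :: 'a and r by auto
    ultimately have "?V \<in> sets (borel \<Otimes>\<^sub>M borel)"
      by (intro sets.countable_UN'') auto
    then show "U \<in> sets (borel \<Otimes>\<^sub>M borel)" using V by simp
  qed
  then show "sets borel \<subseteq> sets (borel \<Otimes>\<^sub>M borel :: ('a \<times> 'a) measure)"
    unfolding sets_borel
    using sets.sigma_sets_subset[of "{S. open S}" "borel \<Otimes>\<^sub>M borel :: ('a \<times> 'a) measure"]
    by (auto simp: space_pair_measure)
qed

text \<open>The product measure is a coupling, so the infimum in \<open>W2\<close> ranges over a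
  nonempty set.\<close>

lemma couplings_nonempty:
  fixes \<mu>0 \<mu>1 :: "'a::metric_space measure"
  assumes "compact (UNIV :: 'a set)" and \<mu>0: "\<mu>0 \<in> P2" and \<mu>1: "\<mu>1 \<in> P2"
  shows "couplings \<mu>0 \<mu>1 \<noteq> {}"
proof -
  interpret a: prob_space \<mu>0 using P2_D[OF \<mu>0] by simp
  interpret b: prob_space \<mu>1 using P2_D[OF \<mu>1] by simp
  note s = P2_D(2)[OF \<mu>0] P2_D(2)[OF \<mu>1]
  have s': "sets (\<mu>0 \<Otimes>\<^sub>M \<mu>1) = sets borel"
    using sets_pair_measure_cong[OF s] sets_borel_prod_compact[OF assms(1)] by simp
  have 1: "distr (\<mu>0 \<Otimes>\<^sub>M \<mu>1) borel fst = \<mu>0"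
  proof (rule measure_eqI)
    fix A assume "A \<in> sets (distr (\<mu>0 \<Otimes>\<^sub>M \<mu>1) borel fst)"
    then have A: "A \<in> sets \<mu>0" by (simp add: s)
    have "emeasure (distr (\<mu>0 \<Otimes>\<^sub>M \<mu>1) borel fst) A = emeasure (distr (\<mu>0 \<Otimes>\<^sub>M \<mu>1) \<mu>0 fst) A"
      by (metis distr_cong s(1))
    then show "emeasure (distr (\<mu>0 \<Otimes>\<^sub>M \<mu>1) borel fst) A = emeasure \<mu>0 A"
      using A by (simp add: b.distr_pair_fst b.emeasure_space_1)
  qed (simp add: s)
  have 2: "distr (\<mu>0 \<Otimes>\<^sub>M \<mu>1) borel snd = \<mu>1"
  proof (rule measure_eqI)
    fix A assume "A \<in> sets (distr (\<mu>0 \<Otimes>\<^sub>M \<mu>1) borel snd)"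
    then have A: "A \<in> sets \<mu>1" by (simp add: s)
    have "emeasure (distr (\<mu>0 \<Otimes>\<^sub>M \<mu>1) borel snd) A = emeasure (\<mu>0 \<Otimes>\<^sub>M \<mu>1) (UNIV \<times> A)"
      using A measurable_snd[of \<mu>0 \<mu>1] by (subst emeasure_distr)
        (auto simp: s space_pair_measure P2_D(3)[OF \<mu>0] P2_D(3)[OF \<mu>1] measurable_cong_sets[OF refl s(2)]
          intro!: arg_cong[where f="emeasure (\<mu>0 \<Otimes>\<^sub>M \<mu>1)"])
    also have "\<dots> = emeasure \<mu>1 A"
      using A a.emeasure_space_1 P2_D(3)[OF \<mu>0]
      by (subst b.emeasure_pair_measure_Times) (auto simp: s)
    finally show "emeasure (distr (\<mu>0 \<Otimes>\<^sub>M \<mu>1) borel snd) A = emeasure \<mu>1 A" .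
  qed (simp add: s)
  show ?thesis using s' 1 2 unfolding couplings_def by blast
qed

section \<open>Transport cost and the Wasserstein distance\<close>

definition transport_cost :: "('a::metric_space \<times> 'a) measure \<Rightarrow> real" where
  "transport_cost \<pi> = (\<integral>z. (dist (fst z) (snd z))\<^sup>2 \<partial>\<pi>)"

lemma couplings_D:
  assumes "\<pi> \<in> couplings \<mu>0 \<mu>1" and "\<mu>0 \<in> P2"
  shows "prob_space \<pi>" "sets \<pi> = sets borel" "space \<pi> = UNIV"
    "fst \<in> \<pi> \<rightarrow>\<^sub>M borel" "snd \<in> \<pi> \<rightarrow>\<^sub>M borel"
proof -
  show s: "sets \<pi> = sets borel" using assms by (simp add: couplings_def)
  note [measurable_cong] = s
  show "space \<pi> = UNIV" using sets_eq_imp_space_eq[OF s] by simp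
  have "(fst :: 'a \<times> 'a \<Rightarrow> 'a) \<in> borel_measurable borel" "(snd :: 'a \<times> 'a \<Rightarrow> 'a) \<in> borel_measurable borel"
    by (auto intro!: borel_measurable_continuous_onI continuous_intros)
  then show f: "fst \<in> \<pi> \<rightarrow>\<^sub>M borel" "snd \<in> \<pi> \<rightarrow>\<^sub>M borel" by simp_all
  show "prob_space \<pi>"
    by (rule prob_space_distrD[OF f(1)]) (use assms P2_D(1) in \<open>auto simp: couplings_def\<close>)
qed

lemma couplings_integral:
  fixes f :: "'a::metric_space \<Rightarrow> real"
  assumes "\<pi> \<in> couplings \<mu>0 \<mu>1" and "\<mu>0 \<in> P2" and [measurable]: "f \<in> borel_measurable borel"
  shows "(\<integral>z. f (fst z) \<partial>\<pi>) = (\<integral>x. f x \<partial>\<mu>0)" "(\<integral>z. f (snd z) \<partial>\<pi>) = (\<integral>x. f x \<partial>\<mu>1)"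
proof -
  have "distr \<pi> borel fst = \<mu>0" "distr \<pi> borel snd = \<mu>1"
    using assms by (auto simp: couplings_def)
  then show "(\<integral>z. f (fst z) \<partial>\<pi>) = (\<integral>x. f x \<partial>\<mu>0)" "(\<integral>z. f (snd z) \<partial>\<pi>) = (\<integral>x. f x \<partial>\<mu>1)"
    using integral_distr[OF couplings_D(4)[OF assms(1,2)] assms(3)]
      integral_distr[OF couplings_D(5)[OF assms(1,2)] assms(3)] by simp_all
qed

lemma measurable_dist_couplings:
  assumes "\<pi> \<in> couplings \<mu>0 \<mu>1"
  shows "(\<lambda>z. dist (fst z) (snd z)) \<in> borel_measurable \<pi>"
proof -
  have s: "sets \<pi> = sets borel" using assms by (simp add: couplings_def)
  have "(\<lambda>z::'a\<times>'a. dist (fst z) (snd z)) \<in> borel_measurable borel"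
    by (intro borel_measurable_continuous_onI continuous_intros)
  then show ?thesis using s by (simp cong: measurable_cong_sets)
qed

lemma transport_cost_bounds:
  fixes \<mu>0 \<mu>1 :: "'a::metric_space measure"
  assumes "bounded (UNIV :: 'a set)" "\<mu>0 \<in> P2" "\<pi> \<in> couplings \<mu>0 \<mu>1"
  shows "integrable \<pi> (\<lambda>z. (dist (fst z) (snd z))\<^sup>2)"
    "0 \<le> transport_cost \<pi>" "transport_cost \<pi> \<le> (diameter (UNIV :: 'a set))\<^sup>2"
proof -
  interpret prob_space \<pi> using couplings_D[OF assms(3,2)] by simp
  note [measurable] = measurable_dist_couplings[OF assms(3)]
  have d: "dist x y \<le> diameter (UNIV :: 'a set)" for x y :: 'a
    using diameter_bounded_bound[OF assms(1)] by auto
  show i: "integrable \<pi> (\<lambda>z. (dist (fst z) (snd z))\<^sup>2)"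
    by (rule integrable_const_bound[of _ "(diameter (UNIV :: 'a set))\<^sup>2"])
      (auto intro!: power_mono d)
  show "0 \<le> transport_cost \<pi>" unfolding transport_cost_def by simp
  have "transport_cost \<pi> \<le> (\<integral>z. (diameter (UNIV :: 'a set))\<^sup>2 \<partial>\<pi>)"
    unfolding transport_cost_def using i by (intro integral_mono) (auto intro!: power_mono d)
  then show "transport_cost \<pi> \<le> (diameter (UNIV :: 'a set))\<^sup>2" by (simp add: prob_space)
qed

lemma W2_bounds:
  fixes \<mu>0 \<mu>1 :: "'a::metric_space measure"
  assumes c: "compact (UNIV :: 'a set)" and \<mu>: "\<mu>0 \<in> P2" "\<mu>1 \<in> P2"
  shows "0 \<le> W2 \<mu>0 \<mu>1" "W2 \<mu>0 \<mu>1 \<le> diameter (UNIV :: 'a set)"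
    "(W2 \<mu>0 \<mu>1)\<^sup>2 = (INF \<pi>\<in>couplings \<mu>0 \<mu>1. transport_cost \<pi>)"
proof -
  have b: "bounded (UNIV :: 'a set)" using c compact_imp_bounded by blast
  note t = transport_cost_bounds[OF b \<mu>(1)]
  note ne = couplings_nonempty[OF c \<mu>]
  have 0: "0 \<le> (INF \<pi>\<in>couplings \<mu>0 \<mu>1. transport_cost \<pi>)"
    using ne t by (intro cINF_greatest) auto
  then show "(W2 \<mu>0 \<mu>1)\<^sup>2 = (INF \<pi>\<in>couplings \<mu>0 \<mu>1. transport_cost \<pi>)"
    and "0 \<le> W2 \<mu>0 \<mu>1"
    by (simp_all add: W2_def transport_cost_def)
  obtain \<pi> where \<pi>: "\<pi> \<in> couplings \<mu>0 \<mu>1" using ne by auto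
  have "(INF \<pi>\<in>couplings \<mu>0 \<mu>1. transport_cost \<pi>) \<le> transport_cost \<pi>"
    using \<pi> t by (intro cINF_lower bdd_belowI2) auto
  also have "\<dots> \<le> (diameter (UNIV :: 'a set))\<^sup>2" using t \<pi> by auto
  finally show "W2 \<mu>0 \<mu>1 \<le> diameter (UNIV :: 'a set)"
    using diameter_ge_0[OF b] by (auto simp: W2_def transport_cost_def intro!: real_le_lsqrt)
qed

text \<open>The integral of \<open>(s * f x - t * g x)\<^sup>2\<close> is a nonnegative quadratic
  form in \<open>s\<close> and \<open>t\<close>; suitable values bound its mixed
  coefficient.\<close>

lemma Cauchy_Schwarz_integral:
  fixes f g :: "'a \<Rightarrow> real"
  assumes f: "integrable M (\<lambda>x. (f x)\<^sup>2)" and g: "integrable M (\<lambda>x. (g x)\<^sup>2)"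
    and fg: "integrable M (\<lambda>x. f x * g x)"
  shows "(\<integral>x. f x * g x \<partial>M) \<le> sqrt (\<integral>x. (f x)\<^sup>2 \<partial>M) * sqrt (\<integral>x. (g x)\<^sup>2 \<partial>M)"
proof -
  let ?a = "\<integral>x. (f x)\<^sup>2 \<partial>M" and ?b = "\<integral>x. (g x)\<^sup>2 \<partial>M" and ?c = "\<integral>x. f x * g x \<partial>M"
  have q: "0 \<le> s\<^sup>2 * ?a - 2 * s * t * ?c + t\<^sup>2 * ?b" for s t
  proof -
    have "0 \<le> (\<integral>x. (s * f x - t * g x)\<^sup>2 \<partial>M)" by simp
    also have "\<dots> = (\<integral>x. s\<^sup>2 * (f x)\<^sup>2 - 2 * s * t * (f x * g x) + t\<^sup>2 * (g x)\<^sup>2 \<partial>M)"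
      by (intro Bochner_Integration.integral_cong) (auto simp: power2_eq_square algebra_simps)
    also have "\<dots> = s\<^sup>2 * ?a - 2 * s * t * ?c + t\<^sup>2 * ?b"
      using f g fg by simp
    finally show ?thesis .
  qed
  have a: "?a \<ge> 0" and b: "?b \<ge> 0" by simp_all
  have "?c\<^sup>2 \<le> ?a * ?b"
  proof (cases "?b = 0")
    case True
    have "?c = 0"
    proof (rule ccontr)
      assume c: "?c \<noteq> 0"
      \<comment> \<open>With \<open>?b = 0\<close> the form is affine in \<open>t\<close>, and this
        \<open>t\<close> would give it the value -1.\<close>
      have "0 \<le> ?a - 2 * ((?a + 1) / (2 * ?c)) * ?c" using q[of 1 "(?a + 1) / (2 * ?c)"] True by simp
      then show False using c by simp
    qed
    then show ?thesis using True by simp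
  next
    case False
    \<comment> \<open>The values \<open>s = ?b\<close> and \<open>t = ?c\<close> minimize the form
      up to scaling.\<close>
    have "0 \<le> ?b\<^sup>2 * ?a - 2 * ?b * ?c * ?c + ?c\<^sup>2 * ?b" by (rule q)
    also have "\<dots> = ?b * (?a * ?b - ?c\<^sup>2)" by (simp add: power2_eq_square algebra_simps)
    finally show ?thesis using False b by (simp add: zero_le_mult_iff)
  qed
  then have "?c \<le> sqrt (?a * ?b)" by (rule real_le_rsqrt)
  then show ?thesis by (simp add: real_sqrt_mult)
qed

text \<open>The penalty \<open>C d\<^sup>2\<close> absorbs the pairs of points at a distance where \<open>\<phi>\<close> does not bound the
  descent of \<open>f\<close>; its integral is of second order along a geodesic.\<close>

lemma descent_along_transport:
  fixes f \<phi> :: "'a::metric_space \<Rightarrow> real"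
  assumes c: "compact (UNIV :: 'a set)" and \<mu>: "\<mu>0 \<in> P2" "\<mu>1 \<in> P2"
    and f[measurable]: "f \<in> borel_measurable borel" and fB: "\<And>x. \<bar>f x\<bar> \<le> Bf"
    and \<phi>[measurable]: "\<phi> \<in> borel_measurable borel" and \<phi>B: "\<And>x. \<bar>\<phi> x\<bar> \<le> B\<phi>"
    and descent: "\<And>x y. f x - f y \<le> \<phi> x * dist x y + C * (dist x y)\<^sup>2"
  shows "(\<integral>x. f x \<partial>\<mu>0) - (\<integral>x. f x \<partial>\<mu>1) \<le> sqrt (\<integral>x. (\<phi> x)\<^sup>2 \<partial>\<mu>0) * W2 \<mu>0 \<mu>1 + C * (W2 \<mu>0 \<mu>1)\<^sup>2"
proof -
  have b: "bounded (UNIV :: 'a set)" using c compact_imp_bounded by blast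
  let ?S = "transport_cost ` couplings \<mu>0 \<mu>1"
  let ?A = "sqrt (\<integral>x. (\<phi> x)\<^sup>2 \<partial>\<mu>0)"
  let ?D = "(\<integral>x. f x \<partial>\<mu>0) - (\<integral>x. f x \<partial>\<mu>1)"
  note t = transport_cost_bounds[OF b \<mu>(1)]
  note ne = couplings_nonempty[OF c \<mu>]
  \<comment> \<open>The inequality is a closed condition on the cost, so proving it for every
    coupling gives it at the infimum, without an optimal coupling.\<close>
  let ?T = "{s. ?D \<le> ?A * sqrt s + C * s}"
  have "?S \<subseteq> ?T"
  proof safe
    fix \<pi> assume \<pi>: "\<pi> \<in> couplings \<mu>0 \<mu>1"
    interpret prob_space \<pi> using couplings_D[OF \<pi> \<mu>(1)] by simp
    note [measurable] = measurable_dist_couplings[OF \<pi>] couplings_D(4,5)[OF \<pi> \<mu>(1)]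
    let ?d = "\<lambda>z. dist (fst z) (snd z)"
    have d: "dist x y \<le> diameter (UNIV :: 'a set)" for x y :: 'a
      using diameter_bounded_bound[OF b] by auto
    have i: "integrable \<pi> (\<lambda>z. f (fst z))" "integrable \<pi> (\<lambda>z. f (snd z))"
      by (rule integrable_const_bound[of _ Bf]; simp add: fB)+
    have B0: "0 \<le> B\<phi>" using \<phi>B order_trans[OF abs_ge_zero] by blast
    have i\<phi>: "integrable \<pi> (\<lambda>z. (\<phi> (fst z))\<^sup>2)"
      by (rule integrable_const_bound[of _ "B\<phi>\<^sup>2"]) (auto simp: \<phi>B abs_le_square_iff[symmetric] B0)
    have i\<phi>d: "integrable \<pi> (\<lambda>z. \<phi> (fst z) * ?d z)"
      by (rule integrable_const_bound[of _ "B\<phi> * diameter (UNIV :: 'a set)"])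
        (auto simp: abs_mult intro!: mult_mono \<phi>B d B0)
    have "?D = (\<integral>z. f (fst z) \<partial>\<pi>) - (\<integral>z. f (snd z) \<partial>\<pi>)"
      using couplings_integral[OF \<pi> \<mu>(1) f] by simp
    also have "\<dots> = (\<integral>z. f (fst z) - f (snd z) \<partial>\<pi>)" using i by simp
    also have "\<dots> \<le> (\<integral>z. \<phi> (fst z) * ?d z + C * (?d z)\<^sup>2 \<partial>\<pi>)"
      using i i\<phi>d t[OF \<pi>] by (intro integral_mono) (auto intro: descent)
    also have "\<dots> = (\<integral>z. \<phi> (fst z) * ?d z \<partial>\<pi>) + C * transport_cost \<pi>"
      using i\<phi>d t[OF \<pi>] by (simp add: transport_cost_def)
    \<comment> \<open>Only the first marginal enters the factor with \<open>\<phi>\<close>, so that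
      factor is the same for all couplings.\<close>
    also have "(\<integral>z. \<phi> (fst z) * ?d z \<partial>\<pi>) \<le> sqrt (\<integral>z. (\<phi> (fst z))\<^sup>2 \<partial>\<pi>) * sqrt (\<integral>z. (?d z)\<^sup>2 \<partial>\<pi>)"
      by (rule Cauchy_Schwarz_integral[OF i\<phi> t(1)[OF \<pi>] i\<phi>d])
    also have "(\<integral>z. (\<phi> (fst z))\<^sup>2 \<partial>\<pi>) = (\<integral>x. (\<phi> x)\<^sup>2 \<partial>\<mu>0)"
      using couplings_integral(1)[OF \<pi> \<mu>(1), of "\<lambda>x. (\<phi> x)\<^sup>2"] by simp
    finally show "?D \<le> ?A * sqrt (transport_cost \<pi>) + C * transport_cost \<pi>"
      by (simp add: transport_cost_def)
  qed
  moreover have "closed ?T"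
    by (intro closed_Collect_le continuous_intros)
  ultimately have "closure ?S \<subseteq> ?T" by (rule closure_minimal)
  moreover have "Inf ?S \<in> closure ?S"
    using ne t by (intro closure_contains_Inf) (auto intro!: bdd_belowI2)
  ultimately have "?D \<le> ?A * sqrt (Inf ?S) + C * Inf ?S" by blast
  then show ?thesis
    using W2_bounds(1)[OF c \<mu>] unfolding W2_bounds(3)[OF c \<mu>, symmetric] by simp
qed

section \<open>Descending slopes\<close>

lemma continuous_compact_bounded:
  fixes f :: "'a::topological_space \<Rightarrow> real"
  assumes "compact (UNIV :: 'a set)" "continuous_on UNIV f"
  obtains B where "\<And>x. \<bar>f x\<bar> \<le> B"
proof -
  have "bounded (range f)" using assms compact_continuous_image compact_imp_bounded by blast
  then obtain B where "\<And>x. \<bar>f x\<bar> \<le> B" by (auto simp: bounded_iff)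
  then show ?thesis by (rule that)
qed

lemma continuous_integrable_P2:
  fixes f :: "'a::metric_space \<Rightarrow> real"
  assumes "compact (UNIV :: 'a set)" "continuous_on UNIV f" "\<mu> \<in> P2"
  shows "integrable \<mu> f"
proof -
  interpret prob_space \<mu> using P2_D[OF assms(3)] by simp
  obtain B where B: "\<And>x. \<bar>f x\<bar> \<le> B" using continuous_compact_bounded[OF assms(1,2)] by blast
  have "f \<in> borel_measurable \<mu>"
    using borel_measurable_continuous_onI[OF assms(2)] P2_D(2)[OF assms(3)] by (simp cong: measurable_cong_sets)
  then show ?thesis by (intro integrable_const_bound[of _ B]) (auto simp: B)
qed

text \<open>The descending slope before its limit, along the countable family of radii
  \<open>1 / real (Suc n)\<close>. If the ball contains no second point, the supremum over the empty
  set is 0 in \<open>ennreal\<close>.\<close>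

definition descent_within :: "nat \<Rightarrow> ('a::metric_space \<Rightarrow> real) \<Rightarrow> 'a \<Rightarrow> ennreal" where
  "descent_within n \<rho> x =
     (SUP y\<in>ball x (1 / real (Suc n)) - {x}. ennreal (max (\<rho> x - \<rho> y) 0 / dist x y))"

lemma descent_within_decseq: "decseq (\<lambda>n. descent_within n \<rho> x)"
proof (rule decseq_SucI)
  fix n
  have "1 / real (Suc (Suc n)) \<le> 1 / real (Suc n)" by (simp add: field_simps)
  then have "ball x (1 / real (Suc (Suc n))) - {x} \<subseteq> ball x (1 / real (Suc n)) - {x}"
    using subset_ball[of "1 / real (Suc (Suc n))" "1 / real (Suc n)" x] by blast
  then show "descent_within (Suc n) \<rho> x \<le> descent_within n \<rho> x"
    unfolding descent_within_def by (intro SUP_subset_mono) auto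
qed

text \<open>The radii \<open>1 / real (Suc n)\<close> are cofinal among the positive ones. The
  countable infimum gives measurability of the slope and a sequence to which dominated convergence
  applies.\<close>

lemma descending_slope_eq_INF: "descending_slope \<rho> x = (INF n. descent_within n \<rho> x)"
  unfolding descending_slope_def Limsup_at
proof (rule antisym)
  show "(INF e\<in>{0<..}. SUP y\<in>ball x e - {x}. ennreal (max (\<rho> x - \<rho> y) 0 / dist x y))
      \<le> (INF n. descent_within n \<rho> x)"
    unfolding descent_within_def by (rule INF_mono) (auto intro!: bexI)
  show "(INF n. descent_within n \<rho> x)
      \<le> (INF e\<in>{0<..}. SUP y\<in>ball x e - {x}. ennreal (max (\<rho> x - \<rho> y) 0 / dist x y))"
  proof (rule INF_greatest)
    fix e :: real assume "e \<in> {0<..}"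
    then obtain n where n: "1 / real (Suc n) < e"
      using reals_Archimedean[of e] by (auto simp: inverse_eq_divide)
    have "ball x (1 / real (Suc n)) \<subseteq> ball x e" using n by (intro subset_ball) simp
    then have "descent_within n \<rho> x \<le> (SUP y\<in>ball x e - {x}. ennreal (max (\<rho> x - \<rho> y) 0 / dist x y))"
      unfolding descent_within_def by (intro SUP_subset_mono) auto
    then show "(INF n. descent_within n \<rho> x) \<le> (SUP y\<in>ball x e - {x}. ennreal (max (\<rho> x - \<rho> y) 0 / dist x y))"
      by (rule INF_lower2[OF UNIV_I])
  qed
qed

text \<open>\<^const>\<open>descent_within\<close> is lower semicontinuous, being a supremum of functions of \<open>x\<close> that are
  continuous and nonnegative on an open set and absent elsewhere.\<close>

lemma measurable_descent_within:
  assumes \<rho>: "continuous_on UNIV (\<rho> :: 'a::metric_space \<Rightarrow> real)"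
  shows "descent_within n \<rho> \<in> borel_measurable borel"
proof (rule borel_measurableI_greater)
  fix a :: ennreal
  let ?r = "1 / real (Suc n)"
  have eq: "{x \<in> space borel. a < descent_within n \<rho> x} =
      (\<Union>y. {x. 0 < dist x y \<and> dist x y < ?r \<and> a < ennreal (max (\<rho> x - \<rho> y) 0 / dist x y)})"
    by (auto simp: descent_within_def less_SUP_iff)
  have "open {x. 0 < dist x y \<and> dist x y < ?r \<and> a < ennreal (max (\<rho> x - \<rho> y) 0 / dist x y)}" for y
  proof (cases a)
    case (real b)
    \<comment> \<open>Clearing the positive denominator leaves strict inequalities between
      continuous functions; for infinite \<open>a\<close> the set is empty.\<close>
    have "{x. 0 < dist x y \<and> dist x y < ?r \<and> a < ennreal (max (\<rho> x - \<rho> y) 0 / dist x y)} =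
        {x. 0 < dist x y} \<inter> {x. dist x y < ?r} \<inter> {x. b * dist x y < max (\<rho> x - \<rho> y) 0}"
      using real by (auto simp: ennreal_less_iff pos_less_divide_eq)
    also have "open \<dots>" using \<rho>
      by (intro open_Int open_Collect_less continuous_intros)
    finally show ?thesis .
  qed simp
  then show "{x \<in> space borel. a < descent_within n \<rho> x} \<in> sets borel"
    unfolding eq by (intro borel_open open_UN) auto
qed

lemma descent_within_lipschitz:
  assumes "L-lipschitz_on UNIV \<rho>"
  shows "descent_within n \<rho> x \<le> ennreal L"
  unfolding descent_within_def
proof (intro SUP_least ennreal_leI)
  fix y assume "y \<in> ball x (1 / real (Suc n)) - {x}"
  then have "dist x y > 0" by (auto simp: zero_less_dist_iff)
  moreover have "max (\<rho> x - \<rho> y) 0 \<le> L * dist x y"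
    using lipschitz_onD[OF assms, of x y] lipschitz_on_nonneg[OF assms] by (auto simp: dist_real_def)
  ultimately show "max (\<rho> x - \<rho> y) 0 / dist x y \<le> L" by (simp add: divide_le_eq)
qed

text \<open>Within the radius the difference quotient is one of those in the supremum. Beyond it
  \<open>1 \<le> real (Suc n) * dist x y\<close>, so the Lipschitz bound is at most the quadratic
  term.\<close>

lemma descent_within_bound:
  assumes L: "L-lipschitz_on UNIV \<rho>"
  shows "max (\<rho> x - \<rho> y) 0 \<le> enn2real (descent_within n \<rho> x) * dist x y + L * real (Suc n) * (dist x y)\<^sup>2"
proof (cases "x = y \<or> dist x y \<ge> 1 / real (Suc n)")
  case True
  have L0: "L \<ge> 0" using lipschitz_on_nonneg[OF L] .
  have "max (\<rho> x - \<rho> y) 0 \<le> L * dist x y"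
    using lipschitz_onD[OF L, of x y] L0 by (auto simp: dist_real_def)
  also have "\<dots> \<le> L * (real (Suc n) * dist x y * dist x y)"
  proof (cases "x = y")
    case False
    then have "1 \<le> real (Suc n) * dist x y" using True by (simp add: divide_le_eq mult.commute)
    then have "1 * dist x y \<le> real (Suc n) * dist x y * dist x y" by (intro mult_right_mono) auto
    then show ?thesis using L0 by (intro mult_left_mono) auto
  qed simp
  finally have "max (\<rho> x - \<rho> y) 0 \<le> L * real (Suc n) * (dist x y)\<^sup>2"
    by (simp add: power2_eq_square mult.assoc)
  then show ?thesis by (rule order_trans) simp
next
  case False
  then have d: "dist x y > 0" "y \<in> ball x (1 / real (Suc n)) - {x}" by auto
  have "ennreal (max (\<rho> x - \<rho> y) 0 / dist x y) \<le> descent_within n \<rho> x"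
    unfolding descent_within_def using d(2) by (rule SUP_upper)
  \<comment> \<open>The Lipschitz bound keeps the supremum finite; \<open>enn2real\<close> sends
    infinity to 0 and is monotone only below it.\<close>
  then have "enn2real (ennreal (max (\<rho> x - \<rho> y) 0 / dist x y)) \<le> enn2real (descent_within n \<rho> x)"
    by (rule enn2real_mono)
      (use descent_within_lipschitz[OF L, of n x] in \<open>auto intro: le_less_trans\<close>)
  then have "max (\<rho> x - \<rho> y) 0 / dist x y \<le> enn2real (descent_within n \<rho> x)" by simp
  then have "max (\<rho> x - \<rho> y) 0 \<le> enn2real (descent_within n \<rho> x) * dist x y"
    using d(1) by (simp add: divide_le_eq)
  then show ?thesis by (rule order_trans) (use lipschitz_on_nonneg[OF L] in simp)
qed

lemma descent_within_tendsto:
  assumes L: "L-lipschitz_on UNIV \<rho>"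
  shows "(\<lambda>n. enn2real (descent_within n \<rho> x)) \<longlonglongrightarrow> enn2real (descending_slope \<rho> x)"
proof -
  have "descending_slope \<rho> x \<le> descent_within 0 \<rho> x"
    unfolding descending_slope_eq_INF by (rule INF_lower) simp
  also have "\<dots> \<le> ennreal L" by (rule descent_within_lipschitz[OF L])
  finally have "descending_slope \<rho> x \<le> ennreal L" .
  then have "ennreal (enn2real (descending_slope \<rho> x)) = descending_slope \<rho> x"
    by (intro ennreal_enn2real) (auto intro: le_less_trans)
  moreover have "(\<lambda>n. descent_within n \<rho> x) \<longlonglongrightarrow> descending_slope \<rho> x"
    unfolding descending_slope_eq_INF by (rule LIMSEQ_INF[OF descent_within_decseq])
  ultimately show ?thesis by (intro tendsto_enn2real) auto
qed

section \<open>Entropies along geodesics\<close>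

text \<open>Used after division by the time parameter, to let the remaining term of first order
  vanish.\<close>

lemma le_of_le_add_small:
  fixes h a b :: real
  assumes "\<And>t. 0 < t \<Longrightarrow> t < 1 \<Longrightarrow> h \<le> a + t * b"
  shows "h \<le> a"
proof (rule tendsto_lowerbound)
  show "((\<lambda>t. a + t * b) \<longlongrightarrow> a) (at_right 0)" by (auto intro!: tendsto_eq_intros)
  show "\<forall>\<^sub>F t in at_right 0. h \<le> a + t * b"
    using assms by (auto simp: eventually_at_right_field intro!: exI[of _ 1])
qed simp

text \<open>\<open>V\<close> and \<open>D\<close> are the first and second derivatives of \<open>U\<close>; the last assumption holds because
  the second derivatives of the entropies considered here are convex and decreasing.\<close>

locale entropy_profile =
  fixes U V D :: "real \<Rightarrow> real"
  assumes cont: "continuous_on {0..} U" and U0: "U 0 = 0" and U1: "U 1 = 0"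
    and tangent: "\<And>a r. 0 < a \<Longrightarrow> 0 \<le> r \<Longrightarrow> U a + V a * (r - a) \<le> U r"
    and V_slope: "\<And>a. 0 < a \<Longrightarrow> ereal (V a) \<le> slope_at_infinity U"
    and V_deriv: "\<And>a. 0 < a \<Longrightarrow> (V has_real_derivative D a) (at a)"
    and D_nonneg: "\<And>a. 0 < a \<Longrightarrow> 0 \<le> D a"
    and D_cont: "continuous_on {0<..} D"
    and D_lip: "\<And>m. 0 < m \<Longrightarrow> \<exists>C\<ge>0. \<forall>a b. m \<le> b \<and> b \<le> a \<longrightarrow> D b - D a \<le> C * (a - b)"
begin

text \<open>Averaging the supporting line at the intermediate point \<open>a\<close> gives
  convexity. Supporting lines are available only for \<open>a > 0\<close>; if \<open>a = 0\<close>,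
  both endpoints are 0.\<close>

lemma entropy: "entropy_function U"
proof -
  have "convex_on {0..} U"
  proof (rule convex_onI)
    fix t x y :: real assume t: "0 < t" "t < 1" and x: "x \<in> {0..}" and y: "y \<in> {0..}"
    define a where "a = (1 - t) * x + t * y"
    have "U a \<le> (1 - t) * U x + t * U y"
    proof (cases "a > 0")
      case True
      have "(1 - t) * (U a + V a * (x - a)) + t * (U a + V a * (y - a)) \<le> (1 - t) * U x + t * U y"
        using t x y tangent[OF True] by (intro add_mono mult_left_mono) auto
      moreover have "(1 - t) * (U a + V a * (x - a)) + t * (U a + V a * (y - a)) =
          U a + V a * ((1 - t) * x + t * y - a)"
        by (simp add: algebra_simps)
      ultimately show ?thesis by (simp add: a_def)
    next
      case False
      have "(1 - t) * x \<ge> 0" "t * y \<ge> 0" using t x y by auto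
      then have "(1 - t) * x = 0" "t * y = 0" using False unfolding a_def by linarith+
      then have "x = 0" "y = 0" using t by auto
      then show ?thesis by (simp add: a_def U0)
    qed
    then show "U ((1 - t) *\<^sub>R x + t *\<^sub>R y) \<le> (1 - t) * U x + t * U y" by (simp add: a_def)
  qed simp
  then show ?thesis using cont U0 by (simp add: entropy_function_def)
qed

lemma V_cont: "continuous_on {0<..} V"
  by (intro continuous_at_imp_continuous_on ballI DERIV_isCont[OF V_deriv]) simp

lemma V_mono: "0 < b \<Longrightarrow> b \<le> a \<Longrightarrow> V b \<le> V a"
  by (rule DERIV_nonneg_imp_nondecreasing) (meson V_deriv D_nonneg less_le_trans)+

text \<open>The mean value theorem gives \<open>D\<close> at an unknown intermediate point;
  \<open>D_lip\<close> moves it to the starting value \<open>a\<close> at a quadratic cost. The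
  first-order coefficient then depends on the starting point alone, as transport from
  \<open>\<mu>0\<close> requires.\<close>

lemma V_descent:
  assumes "0 < m"
  obtains C where "0 \<le> C" "\<And>a b. m \<le> a \<Longrightarrow> m \<le> b \<Longrightarrow> V a - V b \<le> D a * max (a - b) 0 + C * (a - b)\<^sup>2"
proof -
  obtain C where C: "0 \<le> C" "\<And>a b. m \<le> b \<Longrightarrow> b \<le> a \<Longrightarrow> D b - D a \<le> C * (a - b)"
    using D_lip[OF assms] by blast
  have "V a - V b \<le> D a * max (a - b) 0 + C * (a - b)\<^sup>2" if "m \<le> a" "m \<le> b" for a b
  proof (cases "b < a")
    case False
    then have "V a - V b \<le> 0" using V_mono[of a b] assms that by simp
    also have "0 \<le> D a * max (a - b) 0 + C * (a - b)\<^sup>2"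
      using False C(1) by (simp add: max_def)
    finally show ?thesis .
  next
    case True
    have "\<exists>z. b < z \<and> z < a \<and> V a - V b = (a - b) * D z"
      using assms that by (intro MVT2 True V_deriv) auto
    then obtain z where z: "b < z" "z < a" "V a - V b = (a - b) * D z" by blast
    have "D z \<le> D a + C * (a - z)" using C(2)[of z a] z that by auto
    also have "C * (a - z) \<le> C * (a - b)" using z C(1) by (intro mult_left_mono) auto
    finally have "(a - b) * D z \<le> (a - b) * (D a + C * (a - b))" using True by (intro mult_left_mono) auto
    then show ?thesis using True z by (simp add: algebra_simps power2_eq_square)
  qed
  then show ?thesis using C(1) that by blast
qed

lemma U_cont_compose:
  assumes "continuous_on UNIV (\<rho> :: 'a::topological_space \<Rightarrow> real)" "\<And>x. \<rho> x > 0"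
  shows "continuous_on UNIV (\<lambda>x. U (\<rho> x))" "continuous_on UNIV (\<lambda>x. V (\<rho> x))" "continuous_on UNIV (\<lambda>x. D (\<rho> x))"
proof -
  have "range \<rho> \<subseteq> {0<..}" "range \<rho> \<subseteq> {0..}" using assms(2) by (auto intro: less_imp_le)
  then show "continuous_on UNIV (\<lambda>x. U (\<rho> x))" "continuous_on UNIV (\<lambda>x. V (\<rho> x))" "continuous_on UNIV (\<lambda>x. D (\<rho> x))"
    using continuous_on_compose2[OF cont assms(1)] continuous_on_compose2[OF V_cont assms(1)]
      continuous_on_compose2[OF D_cont assms(1)] by blast+
qed

lemma measurable_U:
  assumes [measurable]: "f \<in> borel_measurable M" and "\<And>x. f x \<ge> 0"
  shows "(\<lambda>x. U (f x)) \<in> borel_measurable M"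
proof -
  \<comment> \<open>\<open>U\<close> is controlled only on the nonnegative reals, so it is extended
    by a constant before composing.\<close>
  have "continuous_on UNIV (\<lambda>r. U (max r 0))"
    by (rule continuous_on_compose2[OF cont]) (auto intro!: continuous_intros)
  then have [measurable]: "(\<lambda>r. U (max r 0)) \<in> borel_measurable borel"
    by (rule borel_measurable_continuous_onI)
  have "(\<lambda>x. U (max (f x) 0)) \<in> borel_measurable M" by measurable
  then show ?thesis using assms(2) by (simp add: max_absorb1)
qed

section \<open>The functional \<open>U_functional\<close> and its lower bound by
  linearization\<close>

lemma U_functional_ac:
  assumes "\<nu> \<in> P2" "\<mu> \<in> P2" "absolutely_continuous \<nu> \<mu>"
  shows "U_functional U \<nu> \<mu> = ereal_integral \<nu> (\<lambda>x. U (ac_density \<nu> \<mu> x))"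
  using singular_part_ac[OF assms] by (simp add: U_functional_def zero_ennreal.rep_eq)

text \<open>The chosen density agrees with \<rho> only almost everywhere, so integrability and the
  value of the integral are carried over from the continuous integrand.\<close>

lemma U_functional_density:
  assumes c: "compact (UNIV :: 'a::metric_space set)" and \<nu>: "\<nu> \<in> P2"
    and \<mu>: "density \<nu> (\<lambda>x. ennreal (\<rho> x)) \<in> P2"
    and \<rho>: "continuous_on UNIV (\<rho> :: 'a \<Rightarrow> real)" "\<And>x. \<rho> x > 0"
  shows "U_functional U \<nu> (density \<nu> (\<lambda>x. ennreal (\<rho> x))) = ereal (\<integral>x. U (\<rho> x) \<partial>\<nu>)"
proof -
  let ?\<mu> = "density \<nu> (\<lambda>x. ennreal (\<rho> x))"
  note [measurable_cong] = P2_D(2)[OF \<nu>]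
  have \<rho>m: "\<rho> \<in> borel_measurable borel" using \<rho> by (intro borel_measurable_continuous_onI)
  note s = ac_density_density[OF \<nu> \<mu> \<rho>m less_imp_le[OF \<rho>(2)]]
  have am: "ac_density \<nu> ?\<mu> \<in> borel_measurable borel" "\<And>x. ac_density \<nu> ?\<mu> x \<ge> 0"
    using lebesgue_decomposition_canonical[OF \<nu> \<mu>] by (auto simp: lebesgue_decomposition_def)
  have m: "(\<lambda>x. U (ac_density \<nu> ?\<mu> x)) \<in> borel_measurable \<nu>" "(\<lambda>x. U (\<rho> x)) \<in> borel_measurable \<nu>"
    using measurable_U[of _ \<nu>] am \<rho>m less_imp_le[OF \<rho>(2)] by simp_all
  have ae: "AE x in \<nu>. U (\<rho> x) = U (ac_density \<nu> ?\<mu> x)" using s(1) by (auto elim!: eventually_mono)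
  have i: "integrable \<nu> (\<lambda>x. U (\<rho> x))" by (intro continuous_integrable_P2 c \<nu> U_cont_compose \<rho>)
  have i': "integrable \<nu> (\<lambda>x. U (ac_density \<nu> ?\<mu> x))"
    using integrable_cong_AE[OF m(2,1) ae] i by simp
  have e: "(\<integral>x. U (ac_density \<nu> ?\<mu> x) \<partial>\<nu>) = (\<integral>x. U (\<rho> x) \<partial>\<nu>)"
    using integral_cong_AE[OF m(2,1) ae] by simp
  show "U_functional U \<nu> ?\<mu> = ereal (\<integral>x. U (\<rho> x) \<partial>\<nu>)"
    by (simp add: U_functional_def ereal_integral_integrable[OF i'] e s(2) zero_ennreal.rep_eq)
qed

text \<open>Integrating the tangent inequality at \<open>\<rho> x\<close> puts the functional above
  its linearization at \<open>\<rho>\<nu>\<close>. The singular part obeys the same bound, since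
  every \<open>V (\<rho> x)\<close> is at most the slope at infinity.\<close>

lemma U_functional_ge:
  assumes c: "compact (UNIV :: 'a::metric_space set)" and \<nu>: "\<nu> \<in> P2" and \<mu>: "\<mu> \<in> P2"
    and \<rho>: "continuous_on UNIV (\<rho> :: 'a \<Rightarrow> real)" "\<And>x. \<rho> x > 0"
  shows "ereal ((\<integral>x. U (\<rho> x) \<partial>\<nu>) - (\<integral>x. \<rho> x * V (\<rho> x) \<partial>\<nu>) + (\<integral>x. V (\<rho> x) \<partial>\<mu>)) \<le> U_functional U \<nu> \<mu>"
proof -
  let ?r = "ac_density \<nu> \<mu>" and ?s = "singular_part \<nu> \<mu>"
  interpret m: prob_space \<mu> using P2_D[OF \<mu>] by simp
  note [measurable_cong] = P2_D(2)[OF \<nu>] P2_D(2)[OF \<mu>]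
  note dec = lebesgue_decomposition_canonical[OF \<nu> \<mu>]
  have am: "?r \<in> borel_measurable borel" "\<And>x. ?r x \<ge> 0" and ss: "sets ?s = sets borel"
    and es: "\<And>B. B \<in> sets borel \<Longrightarrow> emeasure \<mu> B = emeasure (density \<nu> (\<lambda>x. ennreal (?r x))) B + emeasure ?s B"
    using dec by (auto simp: lebesgue_decomposition_def)
  note cont' = U_cont_compose[OF \<rho>]
  have Vm: "(\<lambda>x. V (\<rho> x)) \<in> borel_measurable borel"
    using cont'(2) by (rule borel_measurable_continuous_onI)
  obtain B where B: "\<And>x. \<bar>V (\<rho> x)\<bar> \<le> B" using continuous_compact_bounded[OF c cont'(2)] by blast
  note li = lebesgue_decomposition_integral[OF \<nu> \<mu> dec Vm B]
  \<comment> \<open>On the singular part \<open>V (\<rho> x)\<close> is replaced by its maximum, a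
    single number that can be compared with the slope at infinity, which may be infinite.\<close>
  obtain x0 where x0: "\<And>x. V (\<rho> x) \<le> V (\<rho> x0)"
    using continuous_attains_sup[OF c _ cont'(2)] by auto
  have iU: "integrable \<nu> (\<lambda>x. U (\<rho> x))" by (intro continuous_integrable_P2 c \<nu> cont')
  have iV: "integrable \<nu> (\<lambda>x. \<rho> x * V (\<rho> x))"
    by (intro continuous_integrable_P2 c \<nu> continuous_intros cont' \<rho>)
  have "ereal (\<integral>x. U (\<rho> x) - \<rho> x * V (\<rho> x) + ?r x * V (\<rho> x) \<partial>\<nu>) \<le> ereal_integral \<nu> (\<lambda>x. U (?r x))"
  proof (rule ereal_integral_ge)
    show "integrable \<nu> (\<lambda>x. U (\<rho> x) - \<rho> x * V (\<rho> x) + ?r x * V (\<rho> x))" using iU iV li by simp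
    show "(\<lambda>x. U (?r x)) \<in> borel_measurable \<nu>" using am by (intro measurable_U) auto
    show "U (\<rho> x) - \<rho> x * V (\<rho> x) + ?r x * V (\<rho> x) \<le> U (?r x)" for x
      using tangent[OF \<rho>(2) am(2), of x x] by (simp add: algebra_simps)
  qed
  moreover have "ereal (\<integral>x. V (\<rho> x) \<partial>?s) \<le> slope_at_infinity U * enn2ereal (emeasure ?s UNIV)"
  proof -
    have "emeasure ?s UNIV \<le> emeasure \<mu> UNIV" using es[of UNIV] by simp
    then have fin: "emeasure ?s UNIV < \<infinity>" using m.emeasure_finite[of UNIV] by (metis infinity_ennreal_def less_top order_le_less_trans)
    interpret s: finite_measure ?s
      using fin sets_eq_imp_space_eq[OF ss] by (intro finite_measureI) auto
    have "(\<integral>x. V (\<rho> x) \<partial>?s) \<le> (\<integral>x. V (\<rho> x0) \<partial>?s)"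
      using li(2) x0 by (intro integral_mono) auto
    also have "\<dots> = V (\<rho> x0) * measure ?s UNIV"
      using sets_eq_imp_space_eq[OF ss] by simp
    finally have "ereal (\<integral>x. V (\<rho> x) \<partial>?s) \<le> ereal (V (\<rho> x0)) * enn2ereal (emeasure ?s UNIV)"
      by (simp add: s.emeasure_eq_measure enn2ereal_ennreal)
    also have "\<dots> \<le> slope_at_infinity U * enn2ereal (emeasure ?s UNIV)"
      by (intro ereal_mult_right_mono V_slope \<rho>) simp
    finally show ?thesis .
  qed
  ultimately have "ereal (\<integral>x. U (\<rho> x) - \<rho> x * V (\<rho> x) + ?r x * V (\<rho> x) \<partial>\<nu>) + ereal (\<integral>x. V (\<rho> x) \<partial>?s)
      \<le> U_functional U \<nu> \<mu>"
    unfolding U_functional_def by (rule add_mono)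
  then show ?thesis using iU iV li by (simp add: algebra_simps)
qed

text \<open>Linearizing at the constant density 1 gives the lower bound
  \<open>U 1 - V 1 + V 1\<close>, which is 0; this is Jensen's inequality including the singular
  part.\<close>

lemma U_functional_nonneg:
  assumes c: "compact (UNIV :: 'a::metric_space set)" and \<nu>: "(\<nu> :: 'a measure) \<in> P2" and \<mu>: "\<mu> \<in> P2"
  shows "0 \<le> U_functional U \<nu> \<mu>"
proof -
  interpret n: prob_space \<nu> using P2_D[OF \<nu>] by simp
  interpret m: prob_space \<mu> using P2_D[OF \<mu>] by simp
  show ?thesis
    using U_functional_ge[OF c \<nu> \<mu>, of "\<lambda>_. 1"] U1 n.prob_space m.prob_space
    by (simp add: zero_ereal_def[symmetric])
qed

lemma U_functional_self:
  assumes c: "compact (UNIV :: 'a::metric_space set)" and \<nu>: "(\<nu> :: 'a measure) \<in> P2"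
  shows "U_functional U \<nu> \<nu> = 0"
proof -
  have "density \<nu> (\<lambda>x. ennreal 1) = \<nu>" by (simp add: density_1)
  then show ?thesis using U_functional_density[OF c \<nu>, of "\<lambda>_. 1"] \<nu> U1
    by (simp add: zero_ereal_def)
qed

text \<open>One argument for all cases: \<open>k\<close> is the curvature bound for the Boltzmann
  entropy and 0 under nonnegative Ricci curvature. The integral on the right is the Fisher
  information belonging to \<open>U\<close>.\<close>

lemma HWI_inequality:
  fixes \<rho> :: "'a::metric_space \<Rightarrow> real" and \<gamma> :: "real \<Rightarrow> 'a measure"
  assumes c: "compact (UNIV :: 'a set)" and \<nu>: "\<nu> \<in> P2" and \<mu>: "\<mu> \<in> P2"
    and \<mu>\<rho>: "\<mu> = density \<nu> (\<lambda>x. ennreal (\<rho> x))"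
    and \<rho>: "\<And>x. \<rho> x > 0" and L: "L-lipschitz_on UNIV \<rho>"
    and geo: "wasserstein_geodesic \<gamma> \<mu> \<nu>"
    and conv: "\<And>t. 0 < t \<Longrightarrow> t < 1 \<Longrightarrow> U_functional U \<nu> (\<gamma> t) \<le>
      ereal ((1 - t) * (\<integral>x. U (\<rho> x) \<partial>\<nu>) - k * (t * (1 - t) / 2 * (W2 \<mu> \<nu>)\<^sup>2))"
  shows "(\<integral>x. U (\<rho> x) \<partial>\<nu>) \<le>
    W2 \<mu> \<nu> * sqrt (\<integral>x. \<rho> x * (D (\<rho> x) * enn2real (descending_slope \<rho> x))\<^sup>2 \<partial>\<nu>) - k / 2 * (W2 \<mu> \<nu>)\<^sup>2"
proof -
  interpret n: prob_space \<nu> using P2_D[OF \<nu>] by simp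
  note [measurable_cong] = P2_D(2)[OF \<nu>]
  let ?W = "W2 \<mu> \<nu>" and ?h = "\<integral>x. U (\<rho> x) \<partial>\<nu>"
  have L0: "L \<ge> 0" using lipschitz_on_nonneg[OF L] .
  have \<rho>c: "continuous_on UNIV \<rho>" using L by (rule lipschitz_on_continuous_on)
  have [measurable]: "\<rho> \<in> borel_measurable borel" using \<rho>c by (rule borel_measurable_continuous_onI)
  note cont' = U_cont_compose[OF \<rho>c \<rho>]
  have [measurable]: "(\<lambda>x. V (\<rho> x)) \<in> borel_measurable borel" "(\<lambda>x. D (\<rho> x)) \<in> borel_measurable borel"
    using cont' by (auto intro: borel_measurable_continuous_onI)
  note [measurable] = measurable_descent_within[OF \<rho>c]
  obtain BV where BV: "\<And>x. \<bar>V (\<rho> x)\<bar> \<le> BV" using continuous_compact_bounded[OF c cont'(2)] by blast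
  obtain BD where BD: "\<And>x. \<bar>D (\<rho> x)\<bar> \<le> BD" using continuous_compact_bounded[OF c cont'(3)] by blast
  obtain B\<rho> where B\<rho>: "\<And>x. \<bar>\<rho> x\<bar> \<le> B\<rho>" using continuous_compact_bounded[OF c \<rho>c] by blast
  \<comment> \<open>A positive minimum of \<rho> keeps all values away from 0, where
    \<open>V\<close> and \<open>D\<close> may be singular.\<close>
  obtain x0 where x0: "\<And>x. \<rho> x0 \<le> \<rho> x" using continuous_attains_inf[OF c _ \<rho>c] by auto
  obtain C where C: "0 \<le> C" "\<And>a b. \<rho> x0 \<le> a \<Longrightarrow> \<rho> x0 \<le> b \<Longrightarrow> V a - V b \<le> D a * max (a - b) 0 + C * (a - b)\<^sup>2"
    using V_descent[OF \<rho>[of x0]] by blast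
  have D0: "0 \<le> D (\<rho> x)" for x using D_nonneg \<rho> by simp
  have BD0: "0 \<le> BD" and B\<rho>0: "0 \<le> B\<rho>" using BD B\<rho> order_trans[OF abs_ge_zero] by blast+
  define g where "g n x = enn2real (descent_within n \<rho> x)" for n x
  define \<phi> where "\<phi> n x = D (\<rho> x) * g n x" for n x
  have [measurable]: "g n \<in> borel_measurable borel" for n unfolding g_def by measurable
  have [measurable]: "\<phi> n \<in> borel_measurable borel" for n unfolding \<phi>_def by measurable
  have g0: "0 \<le> g n x" and gL: "g n x \<le> L" for n x
    unfolding g_def using enn2real_mono[OF descent_within_lipschitz[OF L, of n x]] L0 by auto
  have \<phi>B: "\<bar>\<phi> n x\<bar> \<le> BD * L" for n x
    unfolding \<phi>_def abs_mult using BD[of x] gL[of n x] g0[of n x] BD0 by (intro mult_mono) auto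
  \<comment> \<open>The first summand comes from the quadratic error in \<open>V_descent\<close>,
    the second from pairs beyond distance \<open>1 / real (Suc n)\<close>. Growth in
    \<open>n\<close> is harmless, because \<open>t\<close> tends to 0 while \<open>n\<close> is
    fixed.\<close>
  define E where "E n = C * L\<^sup>2 + BD * (L * real (Suc n))" for n
  have descent: "V (\<rho> x) - V (\<rho> y) \<le> \<phi> n x * dist x y + E n * (dist x y)\<^sup>2" for n x y
  proof -
    have "V (\<rho> x) - V (\<rho> y) \<le> D (\<rho> x) * max (\<rho> x - \<rho> y) 0 + C * (\<rho> x - \<rho> y)\<^sup>2"
      using C(2) x0 by blast
    also have "D (\<rho> x) * max (\<rho> x - \<rho> y) 0
        \<le> D (\<rho> x) * (g n x * dist x y + L * real (Suc n) * (dist x y)\<^sup>2)"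
      unfolding g_def using D0 descent_within_bound[OF L] by (intro mult_left_mono) auto
    also have "\<dots> = \<phi> n x * dist x y + D (\<rho> x) * (L * real (Suc n) * (dist x y)\<^sup>2)"
      by (simp add: \<phi>_def algebra_simps)
    also have "D (\<rho> x) * (L * real (Suc n) * (dist x y)\<^sup>2) \<le> BD * (L * real (Suc n) * (dist x y)\<^sup>2)"
      using BD[of x] L0 by (intro mult_right_mono) auto
    also have "C * (\<rho> x - \<rho> y)\<^sup>2 \<le> C * (L * dist x y)\<^sup>2"
      using lipschitz_onD[OF L, of x y] L0 C(1)
      by (intro mult_left_mono abs_le_square_iff[THEN iffD1]) (auto simp: dist_real_def)
    finally show ?thesis
      by (simp add: E_def algebra_simps power_mult_distrib)
  qed
  have \<mu>int: "(\<integral>x. f x \<partial>\<mu>) = (\<integral>x. \<rho> x * f x \<partial>\<nu>)" if [measurable]: "f \<in> borel_measurable borel" for f :: "'a \<Rightarrow> real"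
    unfolding \<mu>\<rho> using less_imp_le[OF \<rho>] by (subst integral_density) auto
  have step: "?h \<le> sqrt (\<integral>x. \<rho> x * (\<phi> n x)\<^sup>2 \<partial>\<nu>) * ?W - k / 2 * ?W\<^sup>2" for n
  proof (rule le_of_le_add_small)
    fix t :: real assume t: "0 < t" "t < 1"
    let ?A = "sqrt (\<integral>x. \<rho> x * (\<phi> n x)\<^sup>2 \<partial>\<nu>)"
    have \<gamma>: "\<gamma> t \<in> P2" and W: "W2 \<mu> (\<gamma> t) = t * ?W"
      using geo t unfolding wasserstein_geodesic_def
      by (simp, metis abs_of_pos abs_minus_commute atLeastAtMost_iff diff_zero less_imp_le order_refl zero_le_one)
    have "(\<integral>x. V (\<rho> x) \<partial>\<mu>) - (\<integral>x. V (\<rho> x) \<partial>\<gamma> t)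
        \<le> sqrt (\<integral>x. (\<phi> n x)\<^sup>2 \<partial>\<mu>) * (t * ?W) + E n * (t * ?W)\<^sup>2"
      unfolding W[symmetric]
      by (rule descent_along_transport[OF c \<mu> \<gamma> _ BV _ \<phi>B descent]) measurable
    then have "(\<integral>x. \<rho> x * V (\<rho> x) \<partial>\<nu>) - (\<integral>x. V (\<rho> x) \<partial>\<gamma> t) \<le> ?A * (t * ?W) + E n * (t * ?W)\<^sup>2"
      by (simp add: \<mu>int)
    moreover have "?h - (\<integral>x. \<rho> x * V (\<rho> x) \<partial>\<nu>) + (\<integral>x. V (\<rho> x) \<partial>\<gamma> t)
        \<le> (1 - t) * ?h - k * (t * (1 - t) / 2 * ?W\<^sup>2)"
      using order_trans[OF U_functional_ge[OF c \<nu> \<gamma> \<rho>c \<rho>] conv[OF t]] by simp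
    \<comment> \<open>Adding the two bounds cancels the integrals of \<open>V (\<rho> x)\<close>,
      and \<open>?h - (1 - t) * ?h\<close> leaves \<open>t * ?h\<close>.\<close>
    ultimately have "t * ?h \<le> ?A * (t * ?W) + E n * (t * ?W)\<^sup>2 - k * (t * (1 - t) / 2 * ?W\<^sup>2)"
      by (simp add: algebra_simps)
    also have "\<dots> = t * (?A * ?W - k / 2 * ?W\<^sup>2 + t * (E n * ?W\<^sup>2 + k / 2 * ?W\<^sup>2))"
      by (simp add: field_simps power2_eq_square)
    finally show "?h \<le> ?A * ?W - k / 2 * ?W\<^sup>2 + t * (E n * ?W\<^sup>2 + k / 2 * ?W\<^sup>2)"
      using t by simp
  qed
  \<comment> \<open>Now \<open>n\<close> tends to infinity. The Lipschitz constant and the bounds of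
    \<rho> and \<open>D (\<rho> x)\<close> give a constant dominating function.\<close>
  have "(\<lambda>n. \<integral>x. \<rho> x * (\<phi> n x)\<^sup>2 \<partial>\<nu>) \<longlonglongrightarrow>
      (\<integral>x. \<rho> x * (D (\<rho> x) * enn2real (descending_slope \<rho> x))\<^sup>2 \<partial>\<nu>)"
  proof (rule integral_dominated_convergence[where w="\<lambda>_. B\<rho> * (BD * L)\<^sup>2"])
    have "descending_slope \<rho> \<in> borel_measurable borel"
      unfolding descending_slope_eq_INF[abs_def] by measurable
    then show "(\<lambda>x. \<rho> x * (D (\<rho> x) * enn2real (descending_slope \<rho> x))\<^sup>2) \<in> borel_measurable \<nu>"
      by measurable
    show "AE x in \<nu>. (\<lambda>n. \<rho> x * (\<phi> n x)\<^sup>2) \<longlonglongrightarrow> \<rho> x * (D (\<rho> x) * enn2real (descending_slope \<rho> x))\<^sup>2"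
      unfolding \<phi>_def g_def by (intro AE_I2 tendsto_intros descent_within_tendsto[OF L])
    show "AE x in \<nu>. norm (\<rho> x * (\<phi> n x)\<^sup>2) \<le> B\<rho> * (BD * L)\<^sup>2" for n
    proof (rule AE_I2)
      fix x
      have "\<bar>\<phi> n x\<bar> \<le> \<bar>BD * L\<bar>" using \<phi>B[of n x] by simp
      then have "(\<phi> n x)\<^sup>2 \<le> (BD * L)\<^sup>2" by (rule abs_le_square_iff[THEN iffD1])
      then show "norm (\<rho> x * (\<phi> n x)\<^sup>2) \<le> B\<rho> * (BD * L)\<^sup>2"
        using B\<rho>[of x] B\<rho>0 by (simp add: abs_mult mult_mono)
    qed
  qed auto
  then have "(\<lambda>n. sqrt (\<integral>x. \<rho> x * (\<phi> n x)\<^sup>2 \<partial>\<nu>) * ?W - k / 2 * ?W\<^sup>2) \<longlonglongrightarrow>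
      sqrt (\<integral>x. \<rho> x * (D (\<rho> x) * enn2real (descending_slope \<rho> x))\<^sup>2 \<partial>\<nu>) * ?W - k / 2 * ?W\<^sup>2"
    by (intro tendsto_intros)
  then have "?h \<le> sqrt (\<integral>x. \<rho> x * (D (\<rho> x) * enn2real (descending_slope \<rho> x))\<^sup>2 \<partial>\<nu>) * ?W - k / 2 * ?W\<^sup>2"
    using step by (intro LIMSEQ_le_const) auto
  then show ?thesis by (simp add: mult.commute)
qed

end

section \<open>The Boltzmann and Renyi entropies\<close>

interpretation boltzmann: entropy_profile "\<lambda>r. r * ln r" "\<lambda>r. 1 + ln r" "\<lambda>r. 1 / r"
proof
  show "continuous_on {0..} (\<lambda>r::real. r * ln r)"
    unfolding continuous_on_def
  proof
    fix x :: real assume "x \<in> {0..}"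
    show "((\<lambda>r. r * ln r) \<longlongrightarrow> x * ln x) (at x within {0..})"
    proof (cases "x = 0")
      case True
      \<comment> \<open>Only the endpoint 0 needs a limit; the product there is 0 whatever value
        \<open>ln 0\<close> has.\<close>
      have "((\<lambda>r::real. r * ln r) \<longlongrightarrow> 0) (at_right 0)" by real_asymp
      then show ?thesis using True by (simp add: at_within_Ici_at_right)
    next
      case False
      then show ?thesis by (auto intro!: tendsto_intros)
    qed
  qed
  show "a * ln a + (1 + ln a) * (r - a) \<le> r * ln r" if "0 < a" "0 \<le> r" for a r :: real
  proof (cases "r = 0")
    case False
    then have r: "r > 0" using that by simp
    \<comment> \<open>The tangent inequality is \<open>ln x \<le> x - 1\<close> at
      \<open>x = a / r\<close>, multiplied by \<open>r\<close>.\<close>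
    have "ln (a / r) \<le> a / r - 1" using r that by (intro ln_le_minus_one) simp
    then have "r * (ln a - ln r) \<le> r * (a / r - 1)"
      using r that by (intro mult_left_mono) (auto simp: ln_div)
    also have "\<dots> = a - r" using r by (simp add: field_simps)
    finally show ?thesis by (simp add: algebra_simps)
  qed (use that in \<open>simp add: algebra_simps\<close>)
  have "((\<lambda>r::real. ereal (r * ln r / r)) \<longlongrightarrow> \<infinity>) at_top"
    unfolding tendsto_PInfty_eq_at_top by real_asymp
  then have "slope_at_infinity (\<lambda>r. r * ln r) = \<infinity>"
    unfolding slope_at_infinity_def by (intro tendsto_Lim) auto
  then show "ereal (1 + ln a) \<le> slope_at_infinity (\<lambda>r. r * ln r)" for a by simp
  show "((\<lambda>r. 1 + ln r) has_real_derivative 1 / a) (at a)" if "0 < a" for a :: real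
    using that by (auto intro!: derivative_eq_intros)
  show "continuous_on {0<..} (\<lambda>r::real. 1 / r)" by (auto intro!: continuous_intros)
  show "\<exists>C\<ge>0. \<forall>a b. m \<le> b \<and> b \<le> a \<longrightarrow> 1 / b - 1 / a \<le> C * (a - b)" if m: "0 < m" for m :: real
  proof (intro exI[of _ "1 / m\<^sup>2"] conjI allI impI)
    fix a b assume ab: "m \<le> b \<and> b \<le> a"
    have "1 / b - 1 / a = 1 / (b * a) * (a - b)" using ab m by (simp add: field_simps)
    also have "\<dots> \<le> 1 / m\<^sup>2 * (a - b)"
      unfolding power2_eq_square using ab m by (intro mult_right_mono divide_left_mono mult_mono) auto
    finally show "1 / b - 1 / a \<le> 1 / m\<^sup>2 * (a - b)" .
  qed simp
qed auto

text \<open>The transformed function is \<open>- l\<close>, which is affine.\<close>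

lemma boltzmann_DC: "(\<lambda>r. r * ln r) \<in> DC \<infinity>"
proof -
  have "(\<lambda>l. exp l * (exp (- l) * ln (exp (- l)))) = (\<lambda>l::real. - l)"
    by (simp only: ln_exp mult.assoc[symmetric] exp_minus_inverse mult_1)
  moreover have "convex_on UNIV (\<lambda>l::real. - l)" by (rule convex_onI) (auto simp: algebra_simps)
  ultimately show ?thesis using boltzmann.entropy by (simp add: DC_def)
qed

text \<open>The pressure of \<open>r * ln r\<close> is \<open>r\<close>, so the infimum is over the
  constant \<open>K\<close>.\<close>

lemma lambda_const_boltzmann: "lambda_const K (\<lambda>r. r * ln r) = ereal K"
proof -
  have p: "pressure (\<lambda>r. r * ln r) r = r" if r: "r > 0" for r
  proof -
    have "((\<lambda>r. r * ln r) has_real_derivative (1 + ln r)) (at r)"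
      using r by (auto intro!: derivative_eq_intros)
    then have "((\<lambda>s. (s * ln s - r * ln r) / (s - r)) \<longlongrightarrow> 1 + ln r) (at_right r)"
      using has_field_derivative_at_within[of _ _ r "{r<..}"] by (auto simp: has_field_derivative_iff)
    then have "right_deriv (\<lambda>r. r * ln r) r = 1 + ln r"
      unfolding right_deriv_def by (intro tendsto_Lim) auto
    then show ?thesis by (simp add: pressure_def algebra_simps)
  qed
  have "(\<lambda>r. ereal (K * pressure (\<lambda>r. r * ln r) r / r)) ` {0<..} = (\<lambda>r::real. ereal K) ` {0<..}"
    by (intro image_cong[OF refl]) (simp add: p)
  then show ?thesis by (simp add: lambda_const_def)
qed

lemma H_infinity_ac:
  assumes "\<nu> \<in> P2" "\<mu> \<in> P2" "absolutely_continuous \<nu> \<mu>"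
  shows "H \<infinity> \<nu> \<mu> = U_functional (\<lambda>r. r * ln r) \<nu> \<mu>"
  using assms boltzmann.U_functional_ac[OF assms] by (simp add: H_def)

text \<open>The summand \<open>n * r\<close> integrates to the constant \<open>n\<close> of
  \<open>H\<close> for a probability density. It makes \<open>U\<close> vanish at both 0 and 1, as
  the profile requires.\<close>

lemma renyi_entropy_profile:
  assumes n: "1 < n"
  shows "entropy_profile (\<lambda>r. n * r - n * r powr (1 - 1 / n)) (\<lambda>r. n - (n - 1) * r powr (- 1 / n))
    (\<lambda>r. (n - 1) / n * r powr (- 1 / n - 1))"
proof
  have p: "0 < 1 - 1 / n" using n by simp
  show "continuous_on {0..} (\<lambda>r. n * r - n * r powr (1 - 1 / n))"
    using p by (intro continuous_intros continuous_on_powr') auto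
  show "(n * a - n * a powr (1 - 1 / n)) + (n - (n - 1) * a powr (- 1 / n)) * (r - a)
      \<le> n * r - n * r powr (1 - 1 / n)" if a: "0 < a" and r0: "0 \<le> r" for a r
  proof -
    have aa: "a powr (- 1 / n) * a = a powr (1 - 1 / n)"
      using a by (simp add: powr_diff powr_minus_divide)
    have "r powr (1 - 1 / n) \<le> 1 / n * a powr (1 - 1 / n) + (1 - 1 / n) * a powr (- 1 / n) * r"
    proof (cases "r = 0")
      case False
      \<comment> \<open>Weighted arithmetic-geometric mean with weights \<open>1 - 1 / n\<close> and
        \<open>1 / n\<close>; dividing by \<open>a powr (1 / n)\<close> yields the tangent
        inequality.\<close>
      have "r powr (1 - 1 / n) * a powr (1 / n) \<le> (1 - 1 / n) * r + 1 / n * a"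
        using n p a r0 False by (intro Youngs_inequality_0) auto
      then have "a powr (- 1 / n) * (r powr (1 - 1 / n) * a powr (1 / n))
          \<le> a powr (- 1 / n) * ((1 - 1 / n) * r + 1 / n * a)"
        by (intro mult_left_mono) auto
      also have "\<dots> = 1 / n * (a powr (- 1 / n) * a) + (1 - 1 / n) * a powr (- 1 / n) * r"
        by (simp add: algebra_simps)
      also have "a powr (- 1 / n) * (r powr (1 - 1 / n) * a powr (1 / n)) = r powr (1 - 1 / n)"
        using a by (simp add: powr_minus_divide)
      finally show ?thesis unfolding aa .
    qed (use n p in simp)
    then have "n * r powr (1 - 1 / n) \<le> n * (1 / n * a powr (1 - 1 / n) + (1 - 1 / n) * a powr (- 1 / n) * r)"
      using n by (intro mult_left_mono) auto
    also have "\<dots> = a powr (1 - 1 / n) + (n - 1) * a powr (- 1 / n) * r"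
      using n by (simp add: field_simps)
    finally show ?thesis using aa by (simp add: algebra_simps)
  qed
  \<comment> \<open>This function is \<open>U r / r\<close>; its limit \<open>n\<close> dominates
    \<open>V\<close>, which subtracts a nonnegative term from \<open>n\<close>.\<close>
  have "((\<lambda>r::real. n - n * r powr (- 1 / n)) \<longlongrightarrow> n - n * 0) at_top"
    using n by (intro tendsto_intros tendsto_neg_powr filterlim_ident) auto
  moreover have "\<forall>\<^sub>F r in at_top. n - n * r powr (- 1 / n) = (n * r - n * r powr (1 - 1 / n)) / r"
    using eventually_gt_at_top[of 0]
  proof eventually_elim
    case (elim r)
    then have "r powr (1 - 1 / n) = r * r powr (- 1 / n)" by (simp add: powr_diff powr_minus_divide)
    then show ?case using elim by (simp add: field_simps)
  qed
  ultimately have "((\<lambda>r. ereal ((n * r - n * r powr (1 - 1 / n)) / r)) \<longlongrightarrow> ereal n) at_top"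
    by (auto intro: Lim_transform_eventually)
  then have "slope_at_infinity (\<lambda>r. n * r - n * r powr (1 - 1 / n)) = ereal n"
    unfolding slope_at_infinity_def by (intro tendsto_Lim) auto
  then show "ereal (n - (n - 1) * a powr (- 1 / n)) \<le> slope_at_infinity (\<lambda>r. n * r - n * r powr (1 - 1 / n))" for a
    using n by simp
  show "((\<lambda>r. n - (n - 1) * r powr (- 1 / n)) has_real_derivative (n - 1) / n * a powr (- 1 / n - 1)) (at a)"
    if "0 < a" for a
    using that n by (auto intro!: derivative_eq_intros simp: field_simps)
  show "continuous_on {0<..} (\<lambda>r. (n - 1) / n * r powr (- 1 / n - 1))"
    using n by (auto intro!: continuous_intros)
  show "\<exists>C\<ge>0. \<forall>a b. m \<le> b \<and> b \<le> a \<longrightarrow>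
      (n - 1) / n * b powr (- 1 / n - 1) - (n - 1) / n * a powr (- 1 / n - 1) \<le> C * (a - b)" if m: "0 < m" for m
  proof (intro exI conjI allI impI)
    \<comment> \<open>The derivative of \<open>D\<close> is
      \<open>- ?c * z powr (- 1 / n - 2)\<close>; on values at least \<open>m\<close> its modulus is
      bounded by that at \<open>m\<close>.\<close>
    let ?c = "(n - 1) / n * (1 / n + 1)"
    show "0 \<le> ?c * m powr (- 1 / n - 2)" using n by simp
    fix a b assume ab: "m \<le> b \<and> b \<le> a"
    let ?D = "\<lambda>r. (n - 1) / n * r powr (- 1 / n - 1)"
    show "?D b - ?D a \<le> ?c * m powr (- 1 / n - 2) * (a - b)"
    proof (cases "a = b")
      case False
      have "\<exists>z. b < z \<and> z < a \<and> ?D a - ?D b = (a - b) * (- ?c * z powr (- 1 / n - 2))"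
      proof (rule MVT2)
        show "b < a" using ab False by simp
        fix z assume "b \<le> z" "z \<le> a"
        then have "z > 0" using ab m by simp
        then have "(?D has_real_derivative (n - 1) / n * ((- 1 / n - 1) * z powr (- 1 / n - 1 - 1))) (at z)"
          by (intro DERIV_cmult has_real_derivative_powr)
        moreover have "- 1 / n - 1 - 1 = - 1 / n - 2" by simp
        moreover have "(n - 1) / n * ((- 1 / n - 1) * w) = - ?c * w" for w
          using n by (simp add: field_simps)
        ultimately show "(?D has_real_derivative - ?c * z powr (- 1 / n - 2)) (at z)"
          by (simp only:)
      qed
      then obtain z where z: "b < z" "z < a" "?D a - ?D b = (a - b) * (- ?c * z powr (- 1 / n - 2))" by blast
      have "- 1 / n - 2 \<le> 0" using n by (simp add: field_simps)
      then have "z powr (- 1 / n - 2) \<le> m powr (- 1 / n - 2)"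
        using z ab m by (intro powr_mono2') auto
      then have "(a - b) * (?c * z powr (- 1 / n - 2)) \<le> (a - b) * (?c * m powr (- 1 / n - 2))"
        using n ab by (intro mult_left_mono) auto
      then show ?thesis using z(3) by (simp add: algebra_simps)
    qed simp
  qed
qed (use n in auto)

text \<open>For positive \<open>l\<close> the transformed function equals \<open>n - n * l\<close>,
  which is affine.\<close>

lemma renyi_DC:
  assumes n: "1 < n"
  shows "(\<lambda>r. n * r - n * r powr (1 - 1 / n)) \<in> DC (ereal n)"
proof -
  interpret entropy_profile "\<lambda>r. n * r - n * r powr (1 - 1 / n)" "\<lambda>r. n - (n - 1) * r powr (- 1 / n)"
    "\<lambda>r. (n - 1) / n * r powr (- 1 / n - 1)"
    by (rule renyi_entropy_profile[OF n])
  have "l powr n * (n * l powr (- n) - n * (l powr (- n)) powr (1 - 1 / n)) = n - n * l" if "l > 0" for l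
  proof -
    have "- n * (1 - 1 / n) = 1 - n" using n by (simp add: field_simps)
    then have "l powr n * (l powr (- n)) powr (1 - 1 / n) = l"
      using that by (simp add: powr_powr flip: powr_add)
    moreover have "l powr n * l powr (- n) = 1" using that by (simp flip: powr_add)
    ultimately show ?thesis by (simp add: algebra_simps)
  qed
  note eq = this
  have "convex_on {0<..} (\<lambda>l. l powr n * (n * l powr (- n) - n * (l powr (- n)) powr (1 - 1 / n)))"
  proof (rule convex_onI)
    fix t x y :: real assume txy: "0 < t" "t < 1" "x \<in> {0<..}" "y \<in> {0<..}"
    then have "(1 - t) *\<^sub>R x + t *\<^sub>R y > 0" by (simp add: add_pos_pos)
    then show "((1 - t) *\<^sub>R x + t *\<^sub>R y) powr n * (n * ((1 - t) *\<^sub>R x + t *\<^sub>R y) powr (- n)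
        - n * (((1 - t) *\<^sub>R x + t *\<^sub>R y) powr (- n)) powr (1 - 1 / n))
      \<le> (1 - t) * (x powr n * (n * x powr (- n) - n * (x powr (- n)) powr (1 - 1 / n)))
        + t * (y powr n * (n * y powr (- n) - n * (y powr (- n)) powr (1 - 1 / n)))"
      using txy by (simp only: eq greaterThan_iff) (simp add: algebra_simps)
  qed simp
  then show ?thesis using entropy by (simp add: DC_def)
qed

text \<open>Since \<rho> has integral 1, the constant \<open>n\<close> in \<open>H\<close> can be
  moved under the integral as \<open>n * \<rho> x\<close>, which gives the profile's
  \<open>U\<close>.\<close>

lemma H_finite_density:
  fixes \<rho> :: "'a::metric_space \<Rightarrow> real"
  assumes n: "1 < n" and c: "compact (UNIV :: 'a set)" and \<nu>: "\<nu> \<in> P2"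
    and \<mu>: "density \<nu> (\<lambda>x. ennreal (\<rho> x)) \<in> P2"
    and \<rho>: "continuous_on UNIV \<rho>" "\<And>x. \<rho> x > 0"
  shows "H (ereal n) \<nu> (density \<nu> (\<lambda>x. ennreal (\<rho> x))) = ereal (\<integral>x. n * \<rho> x - n * \<rho> x powr (1 - 1 / n) \<partial>\<nu>)"
proof -
  let ?\<mu> = "density \<nu> (\<lambda>x. ennreal (\<rho> x))"
  interpret m: prob_space ?\<mu> using P2_D[OF \<mu>] by simp
  note [measurable_cong] = P2_D(2)[OF \<nu>]
  have [measurable]: "\<rho> \<in> borel_measurable borel" using \<rho> by (intro borel_measurable_continuous_onI)
  have ae: "AE x in \<nu>. ac_density \<nu> ?\<mu> x = \<rho> x"
    using ac_density_density(1)[OF \<nu> \<mu> _ less_imp_le[OF \<rho>(2)]] by simp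
  have [measurable]: "ac_density \<nu> ?\<mu> \<in> borel_measurable borel"
    using lebesgue_decomposition_canonical[OF \<nu> \<mu>] by (auto simp: lebesgue_decomposition_def)
  have 1: "(\<integral>x. ac_density \<nu> ?\<mu> x powr (1 - 1 / n) \<partial>\<nu>) = (\<integral>x. \<rho> x powr (1 - 1 / n) \<partial>\<nu>)"
    using ae by (intro integral_cong_AE) (auto elim!: eventually_mono)
  have "(\<integral>x. \<rho> x \<partial>\<nu>) = (\<integral>x. 1 \<partial>?\<mu>)"
    using less_imp_le[OF \<rho>(2)] by (subst integral_density) auto
  then have 2: "(\<integral>x. \<rho> x \<partial>\<nu>) = 1" using m.prob_space by simp
  have i: "integrable \<nu> \<rho>" "integrable \<nu> (\<lambda>x. \<rho> x powr (1 - 1 / n))"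
    using \<rho>(2) by (auto intro!: continuous_integrable_P2 c \<nu> \<rho>(1) continuous_intros simp: less_imp_neq[symmetric])
  show ?thesis using i 2 by (simp add: H_def Let_def 1)
qed

section \<open>Geodesics ending at the reference measure, and the inequalities along them\<close>

lemma geodesic_to_reference:
  assumes "nonneg_ricci N \<nu>" "\<nu> \<in> P2" "\<mu> \<in> P2_supp \<nu>" "U \<in> DC N"
    "U_functional U \<nu> \<nu> = 0"
  obtains \<gamma> where "wasserstein_geodesic \<gamma> \<mu> \<nu>"
    "\<And>t. 0 < t \<Longrightarrow> t < 1 \<Longrightarrow> U_functional U \<nu> (\<gamma> t) \<le> ereal (1 - t) * U_functional U \<nu> \<mu>"
proof -
  have "\<nu> \<in> P2_supp \<nu>" using assms(2) by (simp add: P2_supp_def)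
  then obtain \<gamma> where "wasserstein_geodesic \<gamma> \<mu> \<nu>" and
    \<gamma>: "\<And>U t. U \<in> DC N \<Longrightarrow> t \<in> {0..1} \<Longrightarrow> U_functional U \<nu> (\<gamma> t) \<le>
      ereal t * U_functional U \<nu> \<nu> + ereal (1 - t) * U_functional U \<nu> \<mu>"
    using assms(1,3) unfolding nonneg_ricci_def by metis
  moreover have "U_functional U \<nu> (\<gamma> t) \<le> ereal (1 - t) * U_functional U \<nu> \<mu>" if "0 < t" "t < 1" for t
    using \<gamma>[OF assms(4), of t] that assms(5) by simp
  ultimately show ?thesis using that by blast
qed

lemma boltzmann_geodesic_to_reference:
  fixes \<nu> :: "'a::metric_space measure"
  assumes "inf_ricci_ge K \<nu>" "compact (UNIV :: 'a set)" "\<nu> \<in> P2" "\<mu> \<in> P2_supp \<nu>"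
  obtains \<gamma> where "wasserstein_geodesic \<gamma> \<mu> \<nu>"
    "\<And>t. 0 < t \<Longrightarrow> t < 1 \<Longrightarrow> U_functional (\<lambda>r. r * ln r) \<nu> (\<gamma> t) \<le>
      ereal (1 - t) * U_functional (\<lambda>r. r * ln r) \<nu> \<mu> - ereal (K * (t * (1 - t) / 2 * (W2 \<mu> \<nu>)\<^sup>2))"
proof -
  let ?U = "\<lambda>r::real. r * ln r"
  have "\<nu> \<in> P2_supp \<nu>" using assms(3) by (simp add: P2_supp_def)
  then obtain \<gamma> where "wasserstein_geodesic \<gamma> \<mu> \<nu>" and
    \<gamma>: "\<And>U t. U \<in> DC \<infinity> \<Longrightarrow> t \<in> {0..1} \<Longrightarrow> U_functional U \<nu> (\<gamma> t) \<le>
      ereal t * U_functional U \<nu> \<nu> + ereal (1 - t) * U_functional U \<nu> \<mu>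
      - lambda_const K U * ereal (t * (1 - t) / 2 * (W2 \<mu> \<nu>)\<^sup>2)"
    using assms(1,4) unfolding inf_ricci_ge_def by metis
  moreover have "U_functional ?U \<nu> (\<gamma> t) \<le>
      ereal (1 - t) * U_functional ?U \<nu> \<mu> - ereal (K * (t * (1 - t) / 2 * (W2 \<mu> \<nu>)\<^sup>2))" if "0 < t" "t < 1" for t
    using \<gamma>[OF boltzmann_DC, of t] that boltzmann.U_functional_self[OF assms(2,3)]
    by (simp add: lambda_const_boltzmann)
  ultimately show ?thesis using that by blast
qed

lemma talagrand_inequality:
  fixes \<nu> :: "'a::metric_space measure"
  assumes K: "inf_ricci_ge K \<nu>" and c: "compact (UNIV :: 'a set)" and \<nu>: "\<nu> \<in> P2" and \<mu>: "\<mu> \<in> P2_supp \<nu>"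
  shows "ereal (K / 2 * (W2 \<mu> \<nu>)\<^sup>2) \<le> H \<infinity> \<nu> \<mu>"
proof (cases "absolutely_continuous \<nu> \<mu>")
  case False
  then show ?thesis by (simp add: H_def)
next
  case True
  let ?U = "\<lambda>r::real. r * ln r"
  have \<mu>': "\<mu> \<in> P2" using \<mu> by (simp add: P2_supp_def)
  note H = H_infinity_ac[OF \<nu> \<mu>' True]
  obtain \<gamma> where g: "wasserstein_geodesic \<gamma> \<mu> \<nu>"
    and \<gamma>: "\<And>t. 0 < t \<Longrightarrow> t < 1 \<Longrightarrow> U_functional ?U \<nu> (\<gamma> t) \<le>
      ereal (1 - t) * U_functional ?U \<nu> \<mu> - ereal (K * (t * (1 - t) / 2 * (W2 \<mu> \<nu>)\<^sup>2))"
    using boltzmann_geodesic_to_reference[OF K c \<nu> \<mu>] by blast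
  have "U_functional ?U \<nu> \<mu> \<ge> 0" by (rule boltzmann.U_functional_nonneg[OF c \<nu> \<mu>'])
  then show ?thesis
  \<comment> \<open>Only a finite value needs work: nonnegativity excludes minus infinity, and plus
    infinity is trivial.\<close>
  proof (cases "U_functional ?U \<nu> \<mu>")
    case (real h)
    have "K / 2 * (W2 \<mu> \<nu>)\<^sup>2 \<le> h"
    proof (rule le_of_le_add_small)
      \<comment> \<open>With \<open>t = 1 - s\<close>, both the entropy term and the curvature term
        contain the factor \<open>s\<close>, which is divided out before \<open>s\<close> tends to
        0.\<close>
      fix s :: real assume s: "0 < s" "s < 1"
      have "\<gamma> (1 - s) \<in> P2" using g s by (auto simp: wasserstein_geodesic_def)
      then have "0 \<le> U_functional ?U \<nu> (\<gamma> (1 - s))" by (rule boltzmann.U_functional_nonneg[OF c \<nu>])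
      also have "\<dots> \<le> ereal (s * h - K * ((1 - s) * s / 2 * (W2 \<mu> \<nu>)\<^sup>2))"
        using \<gamma>[of "1 - s"] s real by simp
      finally have "s * (K / 2 * (W2 \<mu> \<nu>)\<^sup>2) \<le> s * (h + s * (K / 2 * (W2 \<mu> \<nu>)\<^sup>2))"
        by (simp add: field_simps)
      then show "K / 2 * (W2 \<mu> \<nu>)\<^sup>2 \<le> h + s * (K / 2 * (W2 \<mu> \<nu>)\<^sup>2)" using s by simp
    qed
    then show ?thesis using H real by simp
  qed (auto simp: H)
qed

text \<open>With \<open>D r = 1 / r\<close>, the integrand
  \<open>\<rho> x * (D (\<rho> x) * s)\<^sup>2\<close> is \<open>s\<^sup>2 / \<rho> x\<close>, that
  of the Fisher information.\<close>

lemma boltzmann_HWI: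
  fixes \<rho> :: "'a::metric_space \<Rightarrow> real"
  assumes K: "inf_ricci_ge K \<nu>" and c: "compact (UNIV :: 'a set)" and \<nu>: "\<nu> \<in> P2"
    and \<mu>: "\<mu> \<in> P2_ac \<nu>" and \<mu>\<rho>: "\<mu> = density \<nu> (\<lambda>x. ennreal (\<rho> x))"
    and \<rho>: "\<And>x. \<rho> x > 0" and L: "L-lipschitz_on UNIV \<rho>"
  shows "H \<infinity> \<nu> \<mu> \<le> ereal (W2 \<mu> \<nu> * sqrt (I \<infinity> \<nu> \<rho>) - K / 2 * (W2 \<mu> \<nu>)\<^sup>2)"
proof -
  let ?U = "\<lambda>r::real. r * ln r"
  have \<mu>s: "\<mu> \<in> P2_supp \<nu>" and \<mu>': "\<mu> \<in> P2" and ac: "absolutely_continuous \<nu> \<mu>"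
    using \<mu> by (auto simp: P2_ac_def P2_supp_def)
  have \<rho>c: "continuous_on UNIV \<rho>" using L by (rule lipschitz_on_continuous_on)
  have h: "U_functional ?U \<nu> \<mu> = ereal (\<integral>x. \<rho> x * ln (\<rho> x) \<partial>\<nu>)"
    using boltzmann.U_functional_density[OF c \<nu> _ \<rho>c \<rho>] \<mu>' \<mu>\<rho> by simp
  obtain \<gamma> where g: "wasserstein_geodesic \<gamma> \<mu> \<nu>"
    and \<gamma>: "\<And>t. 0 < t \<Longrightarrow> t < 1 \<Longrightarrow> U_functional ?U \<nu> (\<gamma> t) \<le>
      ereal (1 - t) * U_functional ?U \<nu> \<mu> - ereal (K * (t * (1 - t) / 2 * (W2 \<mu> \<nu>)\<^sup>2))"
    using boltzmann_geodesic_to_reference[OF K c \<nu> \<mu>s] by blast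
  have "(\<integral>x. \<rho> x * ln (\<rho> x) \<partial>\<nu>) \<le>
      W2 \<mu> \<nu> * sqrt (\<integral>x. \<rho> x * (1 / \<rho> x * enn2real (descending_slope \<rho> x))\<^sup>2 \<partial>\<nu>) - K / 2 * (W2 \<mu> \<nu>)\<^sup>2"
    using \<gamma> by (intro boltzmann.HWI_inequality[OF c \<nu> \<mu>' \<mu>\<rho> \<rho> L g]) (simp add: h)
  also have "(\<integral>x. \<rho> x * (1 / \<rho> x * enn2real (descending_slope \<rho> x))\<^sup>2 \<partial>\<nu>) = I \<infinity> \<nu> \<rho>"
    unfolding I_def using \<rho>
    by (auto simp: power2_eq_square intro!: Bochner_Integration.integral_cong)
  finally show ?thesis using h H_infinity_ac[OF \<nu> \<mu>' ac] by simp
qed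

text \<open>The general inequality with \<open>k = 0\<close>, for the Boltzmann entropy if
  \<open>N\<close> is infinite and the Renyi entropy otherwise.\<close>

lemma nonneg_ricci_entropy_bound:
  fixes \<rho> :: "'a::metric_space \<Rightarrow> real"
  assumes R: "nonneg_ricci N \<nu>" and N: "1 < N" and c: "compact (UNIV :: 'a set)" and \<nu>: "\<nu> \<in> P2"
    and \<mu>: "\<mu> \<in> P2_ac \<nu>" and \<mu>\<rho>: "\<mu> = density \<nu> (\<lambda>x. ennreal (\<rho> x))"
    and \<rho>: "\<And>x. \<rho> x > 0" and L: "L-lipschitz_on UNIV \<rho>"
  shows "H N \<nu> \<mu> \<le> ereal (W2 \<mu> \<nu> * sqrt (I N \<nu> \<rho>))"
proof -
  have \<mu>s: "\<mu> \<in> P2_supp \<nu>" and \<mu>': "\<mu> \<in> P2" and ac: "absolutely_continuous \<nu> \<mu>"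
    using \<mu> by (auto simp: P2_ac_def P2_supp_def)
  have \<rho>c: "continuous_on UNIV \<rho>" using L by (rule lipschitz_on_continuous_on)
  show ?thesis
  proof (cases N)
    case PInf
    let ?U = "\<lambda>r::real. r * ln r"
    have h: "U_functional ?U \<nu> \<mu> = ereal (\<integral>x. \<rho> x * ln (\<rho> x) \<partial>\<nu>)"
      using boltzmann.U_functional_density[OF c \<nu> _ \<rho>c \<rho>] \<mu>' \<mu>\<rho> by simp
    obtain \<gamma> where g: "wasserstein_geodesic \<gamma> \<mu> \<nu>"
      and \<gamma>: "\<And>t. 0 < t \<Longrightarrow> t < 1 \<Longrightarrow> U_functional ?U \<nu> (\<gamma> t) \<le> ereal (1 - t) * U_functional ?U \<nu> \<mu>"
      using geodesic_to_reference[OF R[unfolded PInf] \<nu> \<mu>s boltzmann_DC boltzmann.U_functional_self[OF c \<nu>]]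
      by blast
    have "(\<integral>x. \<rho> x * ln (\<rho> x) \<partial>\<nu>) \<le>
        W2 \<mu> \<nu> * sqrt (\<integral>x. \<rho> x * (1 / \<rho> x * enn2real (descending_slope \<rho> x))\<^sup>2 \<partial>\<nu>) - 0 / 2 * (W2 \<mu> \<nu>)\<^sup>2"
      using \<gamma> by (intro boltzmann.HWI_inequality[OF c \<nu> \<mu>' \<mu>\<rho> \<rho> L g]) (simp add: h)
    also have "(\<integral>x. \<rho> x * (1 / \<rho> x * enn2real (descending_slope \<rho> x))\<^sup>2 \<partial>\<nu>) = I N \<nu> \<rho>"
      unfolding I_def PInf using \<rho>
      by (auto simp: power2_eq_square intro!: Bochner_Integration.integral_cong)
    finally show ?thesis using h H_infinity_ac[OF \<nu> \<mu>' ac] PInf by simp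
  next
    case (real n)
    then have n: "1 < n" using N by (simp add: one_ereal_def)
    let ?U = "\<lambda>r. n * r - n * r powr (1 - 1 / n)"
    interpret entropy_profile ?U "\<lambda>r. n - (n - 1) * r powr (- 1 / n)" "\<lambda>r. (n - 1) / n * r powr (- 1 / n - 1)"
      by (rule renyi_entropy_profile[OF n])
    have h: "U_functional ?U \<nu> \<mu> = ereal (\<integral>x. ?U (\<rho> x) \<partial>\<nu>)"
      using U_functional_density[OF c \<nu> _ \<rho>c \<rho>] \<mu>' \<mu>\<rho> by simp
    obtain \<gamma> where g: "wasserstein_geodesic \<gamma> \<mu> \<nu>"
      and \<gamma>: "\<And>t. 0 < t \<Longrightarrow> t < 1 \<Longrightarrow> U_functional ?U \<nu> (\<gamma> t) \<le> ereal (1 - t) * U_functional ?U \<nu> \<mu>"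
      using geodesic_to_reference[OF R[unfolded real] \<nu> \<mu>s renyi_DC[OF n] U_functional_self[OF c \<nu>]]
      by blast
    have "(\<integral>x. ?U (\<rho> x) \<partial>\<nu>) \<le>
        W2 \<mu> \<nu> * sqrt (\<integral>x. \<rho> x * ((n - 1) / n * \<rho> x powr (- 1 / n - 1) * enn2real (descending_slope \<rho> x))\<^sup>2 \<partial>\<nu>)
        - 0 / 2 * (W2 \<mu> \<nu>)\<^sup>2"
      using \<gamma> by (intro HWI_inequality[OF c \<nu> \<mu>' \<mu>\<rho> \<rho> L g]) (simp add: h)
    also have "(\<integral>x. \<rho> x * ((n - 1) / n * \<rho> x powr (- 1 / n - 1) * enn2real (descending_slope \<rho> x))\<^sup>2 \<partial>\<nu>) = I N \<nu> \<rho>"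
    proof -
      \<comment> \<open>The exponents add up to
        \<open>1 + 2 * (- 1 / n - 1) = - (2 / n + 1)\<close>, the power in the Fisher
        information.\<close>
      have "r * ((n - 1) / n * r powr (- 1 / n - 1) * s)\<^sup>2 = ((n - 1) / n)\<^sup>2 * (s\<^sup>2 / r powr (2 / n + 1))"
        if "r > 0" for r s
      proof -
        have "r * (r powr (- 1 / n - 1))\<^sup>2 = r powr (1 + (- 1 / n - 1) + (- 1 / n - 1))"
          unfolding powr_add using that by (simp add: power2_eq_square)
        also have "1 + (- 1 / n - 1) + (- 1 / n - 1) = - (2 / n + 1)" using n by (simp add: field_simps)
        also have "r powr - (2 / n + 1) = 1 / r powr (2 / n + 1)" by (rule powr_minus_divide)
        finally have e: "r * (r powr (- 1 / n - 1))\<^sup>2 = 1 / r powr (2 / n + 1)" .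
        have "r * ((n - 1) / n * r powr (- 1 / n - 1) * s)\<^sup>2 = ((n - 1) / n)\<^sup>2 * (r * (r powr (- 1 / n - 1))\<^sup>2) * s\<^sup>2"
          unfolding power_mult_distrib by simp
        then show ?thesis unfolding e by simp
      qed
      then have "(\<integral>x. \<rho> x * ((n - 1) / n * \<rho> x powr (- 1 / n - 1) * enn2real (descending_slope \<rho> x))\<^sup>2 \<partial>\<nu>) =
          (\<integral>x. ((n - 1) / n)\<^sup>2 * ((enn2real (descending_slope \<rho> x))\<^sup>2 / \<rho> x powr (2 / n + 1)) \<partial>\<nu>)"
        using \<rho> by presburger
      also have "\<dots> = I N \<nu> \<rho>"
        by (subst Bochner_Integration.integral_mult_right_zero) (simp add: I_def real)
      finally show ?thesis .
    qed
    finally show ?thesis using H_finite_density[OF n c \<nu> _ \<rho>c \<rho>] \<mu>' by (simp add: \<mu>\<rho> real)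
  qed (use N in simp)
qed

theorem theorem6p1:
  fixes \<nu> :: "'a::metric_space measure"
  assumes "compact_measured_length_space \<nu>"
  shows
    "(\<forall>K::real. K > 0 \<and> inf_ricci_ge K \<nu> \<longrightarrow>
        (\<forall>\<mu>\<in>P2_supp \<nu>. ereal (K / 2 * (W2 \<mu> \<nu>)\<^sup>2) \<le> H \<infinity> \<nu> \<mu>))
     \<and>
     (\<forall>\<mu>\<in>P2_ac \<nu>. \<forall>\<rho>::'a \<Rightarrow> real.
        \<mu> = density \<nu> (\<lambda>x. ennreal (\<rho> x)) \<and> (\<forall>x. \<rho> x > 0) \<and> (\<exists>L. L-lipschitz_on UNIV \<rho>) \<longrightarrow>
        (\<forall>K::real. K > 0 \<and> inf_ricci_ge K \<nu> \<longrightarrow>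
           H \<infinity> \<nu> \<mu> \<le> ereal (W2 \<mu> \<nu> * sqrt (I \<infinity> \<nu> \<rho>) - K / 2 * (W2 \<mu> \<nu>)\<^sup>2) \<and>
           W2 \<mu> \<nu> * sqrt (I \<infinity> \<nu> \<rho>) - K / 2 * (W2 \<mu> \<nu>)\<^sup>2 \<le> 1 / (2 * K) * I \<infinity> \<nu> \<rho>) \<and>
        (\<forall>K::real. K \<le> 0 \<and> inf_ricci_ge K \<nu> \<longrightarrow>
           H \<infinity> \<nu> \<mu> \<le> ereal (diameter (UNIV :: 'a set) * sqrt (I \<infinity> \<nu> \<rho>)
                              - K / 2 * (diameter (UNIV :: 'a set))\<^sup>2)) \<and>
        (\<forall>N::ereal. 1 < N \<and> nonneg_ricci N \<nu> \<longrightarrow>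
           H N \<nu> \<mu> \<le> ereal (diameter (UNIV :: 'a set) * sqrt (I N \<nu> \<rho>))))"
proof (intro conjI allI ballI impI)
  have c: "compact (UNIV :: 'a set)" and \<nu>: "\<nu> \<in> P2"
    using assms by (auto simp: compact_measured_length_space_def)
  fix K and \<mu> :: "'a measure" assume "K > 0 \<and> inf_ricci_ge K \<nu>" "\<mu> \<in> P2_supp \<nu>"
  then show "ereal (K / 2 * (W2 \<mu> \<nu>)\<^sup>2) \<le> H \<infinity> \<nu> \<mu>"
    using talagrand_inequality[OF _ c \<nu>] by blast
next
  have c: "compact (UNIV :: 'a set)" and \<nu>: "\<nu> \<in> P2"
    using assms by (auto simp: compact_measured_length_space_def)
  fix \<mu> and \<rho> :: "'a \<Rightarrow> real"
  assume \<mu>: "\<mu> \<in> P2_ac \<nu>"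
    and "\<mu> = density \<nu> (\<lambda>x. ennreal (\<rho> x)) \<and> (\<forall>x. \<rho> x > 0) \<and> (\<exists>L. L-lipschitz_on UNIV \<rho>)"
  then obtain L where \<mu>\<rho>: "\<mu> = density \<nu> (\<lambda>x. ennreal (\<rho> x))" and \<rho>: "\<And>x. \<rho> x > 0"
    and L: "L-lipschitz_on UNIV \<rho>" by blast
  have "\<mu> \<in> P2" using \<mu> by (simp add: P2_ac_def P2_supp_def)
  note W = W2_bounds(1,2)[OF c this \<nu>]
  have I0: "0 \<le> I N \<nu> \<rho>" for N
    using less_imp_le[OF \<rho>] by (simp add: I_def Let_def)
  { fix K assume "K > 0 \<and> inf_ricci_ge K \<nu>"
    then show "H \<infinity> \<nu> \<mu> \<le> ereal (W2 \<mu> \<nu> * sqrt (I \<infinity> \<nu> \<rho>) - K / 2 * (W2 \<mu> \<nu>)\<^sup>2)"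
      using boltzmann_HWI[OF _ c \<nu> \<mu> \<mu>\<rho> \<rho> L] by blast
  }
  { fix K :: real assume K: "K > 0 \<and> inf_ricci_ge K \<nu>"
    let ?s = "sqrt (I \<infinity> \<nu> \<rho>)"
    \<comment> \<open>Completing the square in \<open>W2 \<mu> \<nu>\<close>.\<close>
    have "0 \<le> (?s - K * W2 \<mu> \<nu>)\<^sup>2 / (2 * K)" using K by simp
    also have "\<dots> = 1 / (2 * K) * ?s\<^sup>2 - (W2 \<mu> \<nu> * ?s - K / 2 * (W2 \<mu> \<nu>)\<^sup>2)"
      using K by (simp add: power2_eq_square field_simps)
    also have "?s\<^sup>2 = I \<infinity> \<nu> \<rho>" using I0 by simp
    finally show "W2 \<mu> \<nu> * ?s - K / 2 * (W2 \<mu> \<nu>)\<^sup>2 \<le> 1 / (2 * K) * I \<infinity> \<nu> \<rho>" by simp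
  }
  { fix K :: real assume K: "K \<le> 0 \<and> inf_ricci_ge K \<nu>"
    then have "H \<infinity> \<nu> \<mu> \<le> ereal (W2 \<mu> \<nu> * sqrt (I \<infinity> \<nu> \<rho>) + (- K / 2) * (W2 \<mu> \<nu>)\<^sup>2)"
      using boltzmann_HWI[OF _ c \<nu> \<mu> \<mu>\<rho> \<rho> L] by simp
    \<comment> \<open>Since \<open>- K / 2\<close> is nonnegative, the right-hand side increases
      with the distance, so the diameter may replace it.\<close>
    also have "\<dots> \<le> ereal (diameter (UNIV :: 'a set) * sqrt (I \<infinity> \<nu> \<rho>) + (- K / 2) * (diameter (UNIV :: 'a set))\<^sup>2)"
      using W K I0[of \<infinity>] unfolding ereal_less_eq
      by (intro add_mono mult_right_mono mult_left_mono power_mono) auto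
    finally show "H \<infinity> \<nu> \<mu> \<le> ereal (diameter (UNIV :: 'a set) * sqrt (I \<infinity> \<nu> \<rho>)
        - K / 2 * (diameter (UNIV :: 'a set))\<^sup>2)" by simp
  }
  { fix N assume N: "1 < N \<and> nonneg_ricci N \<nu>"
    then have "H N \<nu> \<mu> \<le> ereal (W2 \<mu> \<nu> * sqrt (I N \<nu> \<rho>))"
      using nonneg_ricci_entropy_bound[OF _ _ c \<nu> \<mu> \<mu>\<rho> \<rho> L] by blast
    also have "\<dots> \<le> ereal (diameter (UNIV :: 'a set) * sqrt (I N \<nu> \<rho>))"
      using W I0[of N] by (auto intro!: mult_right_mono)
    finally show "H N \<nu> \<mu> \<le> ereal (diameter (UNIV :: 'a set) * sqrt (I N \<nu> \<rho>))" .
  }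
qed

end
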